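(* For each positive integer $n$ there is a constant $R_n$, depending only on $n$, such that the following holds. Let $R \geq R_n$ and let $\Sigma_1^n, \Sigma_2^n \subset \overline{B_R} \subset \mathbf{R}^{n+1}$ be compact embedded shrinkers (hypersurfaces, possibly with boundary) with $\partial \Sigma_1, \partial \Sigma_2 \subset \partial B_R$ and $B_R \cap \Sigma_i \neq \emptyset$ for $i = 1, 2$. Then $$B_{R_n} \cap \Sigma_1 \cap \Sigma_2 \neq \emptyset .$$
   Context: $B_r$ denotes the open Euclidean ball of radius $r$ centered at the origin. A shrinker is a (smooth) $n$-dimensional submanifold $\Sigma^n \subset \mathbf{R}^{N}$, possibly with boundary, satisfying the shrinker equation $\mathbf{H} = \frac{1}{2} x^{\perp}$, where $x$ is the position vector, $x^\perp$ is its component normal to $\Sigma$, and $\mathbf{H}$ is the mean curvature vector with the sign convention $\mathbf{H} = -\sum_i A(f_i,f_i)$ ($A$ the vector-valued second fundamental form $A(X,Y) = (D_X Y)^\perp$, $D$ the Euclidean derivative, $f_i$ an orthonormal tangent frame). Thus planes through the origin and the sphere of radius $\sqrt{2n}$ centered at the origin are shrinkers. Equivalently, $\Sigma$ is a critical point of the Gaussian area $F(\Sigma) = (4\pi)^{-n/2}\int_\Sigma e^{-|x|^2/4}$. *)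

theory Defs
  imports "HOL-Analysis.Analysis"
begin

text \<open>\<open>Ck_on k U f\<close> and \<open>smooth_on U f\<close> are meant for open \<open>U\<close> only. The class
  \<open>C\<^sup>k\<close> is defined through iterated directional derivatives, which on a finite-dimensional
  domain is the usual notion.\<close>

primrec Ck_on :: "nat \<Rightarrow> 'a::euclidean_space set \<Rightarrow> ('a \<Rightarrow> 'b::real_normed_vector) \<Rightarrow> bool" where
  "Ck_on 0 U f \<longleftrightarrow> continuous_on U f"
| "Ck_on (Suc k) U f \<longleftrightarrow>
     (\<forall>x\<in>U. f differentiable (at x)) \<and>
     (\<forall>v. Ck_on k U (\<lambda>x. frechet_derivative f (at x) v))"

definition smooth_on :: "'a::euclidean_space set \<Rightarrow> ('a \<Rightarrow> 'b::real_normed_vector) \<Rightarrow> bool" where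
  "smooth_on U f \<longleftrightarrow> (\<forall>k. Ck_on k U f)"

definition diffeomorphism ::
    "'a::euclidean_space set \<Rightarrow> 'a set \<Rightarrow> ('a \<Rightarrow> 'a) \<Rightarrow> ('a \<Rightarrow> 'a) \<Rightarrow> bool" where
  "diffeomorphism U V \<phi> \<psi> \<longleftrightarrow>
     open U \<and> open V \<and> homeomorphism U V \<phi> \<psi> \<and> smooth_on U \<phi> \<and> smooth_on V \<psi>"

text \<open>Embedded submanifolds are described by slice charts of the ambient space: near an interior
  point, \<open>\<Sigma>\<close> is straightened to a \<open>d\<close>-dimensional linear subspace \<open>W\<close>, near a boundary point to
  the closed half-space of \<open>W\<close> with inner normal \<open>e\<close>.\<close>

definition manifold_interior :: "nat \<Rightarrow> 'a::euclidean_space set \<Rightarrow> 'a set" where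
  "manifold_interior d \<Sigma> = {p\<in>\<Sigma>. \<exists>U V \<phi> \<psi> W.
     diffeomorphism U V \<phi> \<psi> \<and> p \<in> U \<and> subspace W \<and> dim W = d \<and>
     \<phi> ` (\<Sigma> \<inter> U) = V \<inter> W}"

definition manifold_boundary :: "nat \<Rightarrow> 'a::euclidean_space set \<Rightarrow> 'a set" where
  "manifold_boundary d \<Sigma> = {p\<in>\<Sigma>. \<exists>U V \<phi> \<psi> W e.
     diffeomorphism U V \<phi> \<psi> \<and> p \<in> U \<and> subspace W \<and> dim W = d \<and> e \<in> W \<and> e \<noteq> 0 \<and>
     \<phi> ` (\<Sigma> \<inter> U) = V \<inter> {y\<in>W. 0 \<le> e \<bullet> y} \<and> e \<bullet> \<phi> p = 0}"

definition embedded_submanifold :: "nat \<Rightarrow> 'a::euclidean_space set \<Rightarrow> bool" where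
  "embedded_submanifold d \<Sigma> \<longleftrightarrow> \<Sigma> \<subseteq> manifold_interior d \<Sigma> \<union> manifold_boundary d \<Sigma>"

text \<open>Tangent vectors are one-sided velocities of curves in \<open>\<Sigma>\<close>. At a boundary point these only
  fill a half-space, whence the linear span.\<close>

definition tangent_space :: "'a::euclidean_space set \<Rightarrow> 'a \<Rightarrow> 'a set" where
  "tangent_space \<Sigma> p = span {v. \<exists>\<gamma> \<epsilon>. 0 < \<epsilon> \<and> \<gamma> 0 = p \<and> \<gamma> ` {0..\<epsilon>} \<subseteq> \<Sigma> \<and>
     (\<gamma> has_vector_derivative v) (at 0 within {0..\<epsilon>})}"

definition normal_part :: "'a::euclidean_space set \<Rightarrow> 'a \<Rightarrow> 'a \<Rightarrow> 'a" where
  "normal_part \<Sigma> p x =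
     (THE w. w \<in> (tangent_space \<Sigma> p)\<^sup>\<bottom> \<and> x - w \<in> tangent_space \<Sigma> p)"

text \<open>\<open>A(X,Y) = (D\<^sub>X Y)\<^sup>\<bottom>\<close> is tensorial, so its value at \<open>p\<close> may be computed with any
  smooth tangent field \<open>Y\<close> near \<open>p\<close> that extends the given vector. A smooth field along \<open>\<Sigma>\<close>
  is represented by an extension to an open set of the ambient space.\<close>

definition tangent_field_near ::
    "'a::euclidean_space set \<Rightarrow> 'a \<Rightarrow> ('a \<Rightarrow> 'a) \<Rightarrow> bool" where
  "tangent_field_near \<Sigma> p Y \<longleftrightarrow>
     (\<exists>U. open U \<and> p \<in> U \<and> smooth_on U Y \<and> (\<forall>q\<in>\<Sigma> \<inter> U. Y q \<in> tangent_space \<Sigma> q))"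

definition second_fundamental_form :: "'a::euclidean_space set \<Rightarrow> 'a \<Rightarrow> 'a \<Rightarrow> 'a \<Rightarrow> 'a" where
  "second_fundamental_form \<Sigma> p u v =
     (THE w. \<exists>Y. tangent_field_near \<Sigma> p Y \<and> Y p = v \<and>
        w = normal_part \<Sigma> p (frechet_derivative Y (at p) u))"

definition orthonormal_basis_of :: "'a::euclidean_space set \<Rightarrow> 'a set \<Rightarrow> bool" where
  "orthonormal_basis_of T B \<longleftrightarrow>
     pairwise orthogonal B \<and> (\<forall>b\<in>B. norm b = 1) \<and> span B = T"

text \<open>The trace does not depend on the chosen basis. With this sign the round sphere of radius
  \<open>r\<close> and dimension \<open>d\<close> has \<open>H = (d / r\<^sup>2) x\<close>.\<close>

definition mean_curvature :: "'a::euclidean_space set \<Rightarrow> 'a \<Rightarrow> 'a" where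
  "mean_curvature \<Sigma> p =
     - (\<Sum>b\<in>(SOME B. orthonormal_basis_of (tangent_space \<Sigma> p) B).
          second_fundamental_form \<Sigma> p b b)"

definition shrinker :: "nat \<Rightarrow> 'a::euclidean_space set \<Rightarrow> bool" where
  "shrinker d \<Sigma> \<longleftrightarrow> embedded_submanifold d \<Sigma> \<and>
     (\<forall>p\<in>\<Sigma>. mean_curvature \<Sigma> p = (1/2) *\<^sub>R normal_part \<Sigma> p p)"

end

theory Submission
  imports Defs
begin

text \<open>The proof is a two-point maximum principle. By the maximum principle for \<open>|x|\<^sup>2\<close>, each
  shrinker meets the ball of radius \<open>\<surd>(2n)\<close>. If the two shrinkers were disjoint in a large ball, let
  \<open>\<phi>(x) = \<rho>\<^sup>2 - |x|\<^sup>2\<close> with \<open>\<rho>\<^sup>2 = 400 n\<close> and minimise \<open>|p - q|\<^sup>2 / \<phi>(p)\<^sup>4\<close> over \<open>p \<in> \<Sigma>\<^sub>1 \<inter> B\<^sub>\<rho>\<close> and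
  \<open>q \<in> \<Sigma>\<^sub>2\<close>; let \<open>\<mu>\<close> be the minimum, so that \<open>|p - q|\<^sup>2 - \<mu> \<phi>(p)\<^sup>4\<close> attains its minimum \<open>0\<close>. The first
  variation makes \<open>p - q\<close> normal to \<open>\<Sigma>\<^sub>2\<close> at \<open>q\<close> and \<open>G = 2(p - q) + 8\<mu>\<phi>\<^sup>3 p\<close> normal to \<open>\<Sigma>\<^sub>1\<close> at \<open>p\<close>. Sum
  the second variation over an orthonormal basis of the tangent space at \<open>p\<close>, moving \<open>q\<close> along the
  reflected basis. The shrinker equation turns the curvature terms into \<open>- |p - q|\<^sup>2 - 4\<mu>\<phi>\<^sup>3|p|\<^sup>2\<close>. If
  \<open>c\<close> is the cosine of the angle between the tangent planes, the mismatch of the two bases costs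
  \<open>4(1 - c)\<close>, which the term \<open>- 48\<mu>\<phi>\<^sup>2|p\<^sup>T|\<^sup>2 = - 3(1 - c\<^sup>2)\<close> in the trace of the
  Hessian of \<open>- \<mu>\<phi>\<^sup>4\<close> absorbs, because \<open>c \<ge> 1/3\<close>. What remains is \<open>0 \<le> 8n - \<phi> - 4|p|\<^sup>2\<close>, contradicting
  \<open>\<phi> + |p|\<^sup>2 = \<rho>\<^sup>2\<close>.\<close>

subsection \<open>Smooth maps\<close>

lemma Ck_on_cong:
  assumes "open U" "\<And>x. x \<in> U \<Longrightarrow> f x = g x"
  shows "Ck_on k U f = Ck_on k U g"
proof -
  have "Ck_on k U g" if "Ck_on k U f" "\<And>x. x \<in> U \<Longrightarrow> f x = g x"
    for k and f g :: "'a \<Rightarrow> 'b"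
    using that
  proof (induction k arbitrary: f g)
    case 0
    then show ?case using continuous_on_cong by force
  next
    case (Suc k)
    have "frechet_derivative f (at x) = frechet_derivative g (at x)" if "x \<in> U" for x
      using Suc.prems that by (intro frechet_derivative_transform_within_open[OF _ \<open>open U\<close>]) auto
    moreover have "g differentiable (at x)" if "x \<in> U" for x
    proof -
      from Suc.prems(1) that have "(f has_derivative frechet_derivative f (at x)) (at x)"
        using frechet_derivative_works by auto
      from has_derivative_transform_within_open[OF this \<open>open U\<close> that Suc.prems(2)]
      show ?thesis by (auto simp: differentiable_def)
    qed
    moreover have "Ck_on k U (\<lambda>x. frechet_derivative g (at x) v)" for v
      using Suc.prems(1) calculation(1)
      by - (rule Suc.IH[of "\<lambda>x. frechet_derivative f (at x) v"], simp_all)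
    ultimately show ?case by simp
  qed
  from this[of k f g] this[of k g f] assms(2) show ?thesis by metis
qed

text \<open>Any explicit derivative \<open>f'\<close> may be supplied, so the sum, product and chain
  rules apply without evaluating \<open>frechet_derivative\<close> first.\<close>

lemma Ck_on_Suc_I:
  assumes "open U" "\<And>x. x \<in> U \<Longrightarrow> (f has_derivative f' x) (at x)"
    and "\<And>v. Ck_on k U (\<lambda>x. f' x v)"
  shows "Ck_on (Suc k) U f"
proof -
  have "frechet_derivative f (at x) = f' x" if "x \<in> U" for x
    using assms(2)[OF that] frechet_derivative_at by metis
  then have "Ck_on k U (\<lambda>x. frechet_derivative f (at x) v)" for v
    using assms(3)[of v] Ck_on_cong[OF \<open>open U\<close>, of "\<lambda>x. frechet_derivative f (at x) v" "\<lambda>x. f' x v"]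
    by simp
  then show ?thesis using assms(2) by (auto simp: differentiable_def)
qed

lemma Ck_on_Suc_D:
  assumes "Ck_on (Suc k) U f"
  shows "x \<in> U \<Longrightarrow> (f has_derivative frechet_derivative f (at x)) (at x)"
    and "Ck_on k U (\<lambda>x. frechet_derivative f (at x) v)"
  using assms frechet_derivative_works by auto

lemma Ck_on_Suc_imp: "Ck_on (Suc k) U f \<Longrightarrow> Ck_on k U f"
proof (induction k arbitrary: f)
  case 0
  then show ?case
    by (auto simp: differentiable_imp_continuous_within intro!: continuous_at_imp_continuous_on)
qed auto

lemma Ck_on_const: "Ck_on k U (\<lambda>x. c)"
  by (induction k arbitrary: c) auto

lemma Ck_on_add:
  assumes "open U" "Ck_on k U f" "Ck_on k U g"
  shows "Ck_on k U (\<lambda>x. f x + g x)"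
  using assms(2,3)
proof (induction k arbitrary: f g)
  case 0
  then show ?case by (auto intro: continuous_on_add)
next
  case (Suc k)
  show ?case
    by (rule Ck_on_Suc_I[OF \<open>open U\<close>],
        rule has_derivative_add[OF Ck_on_Suc_D(1)[OF Suc.prems(1)] Ck_on_Suc_D(1)[OF Suc.prems(2)]])
      (assumption | rule Suc.IH Ck_on_Suc_D(2)[OF Suc.prems(1)] Ck_on_Suc_D(2)[OF Suc.prems(2)])+
qed

lemma Ck_on_sum:
  assumes "open U" "\<And>i. i \<in> I \<Longrightarrow> Ck_on k U (f i)"
  shows "Ck_on k U (\<lambda>x. \<Sum>i\<in>I. f i x)"
  using assms(2)
  by (induction I rule: infinite_finite_induct) (auto intro: Ck_on_const Ck_on_add[OF \<open>open U\<close>])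

lemma Ck_on_scaleR:
  assumes "open U" "Ck_on k U f" "Ck_on k U g"
  shows "Ck_on k U (\<lambda>x. f x *\<^sub>R g x)"
  using assms(2,3)
proof (induction k arbitrary: f g)
  case 0
  then show ?case by (auto intro: continuous_on_scaleR)
next
  case (Suc k)
  \<comment> \<open>The product rule leaves \<open>f\<close> and \<open>g\<close> themselves next to
    their derivatives, hence the descent from \<open>Suc k\<close> to \<open>k\<close> by
    \<open>Ck_on_Suc_imp\<close>.\<close>
  show ?case
    by (rule Ck_on_Suc_I[OF \<open>open U\<close>],
        rule has_derivative_scaleR[OF Ck_on_Suc_D(1)[OF Suc.prems(1)] Ck_on_Suc_D(1)[OF Suc.prems(2)]])
      (assumption | rule Ck_on_add[OF \<open>open U\<close>] Suc.IH Ck_on_Suc_imp[OF Suc.prems(1)]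
        Ck_on_Suc_imp[OF Suc.prems(2)] Ck_on_Suc_D(2)[OF Suc.prems(1)] Ck_on_Suc_D(2)[OF Suc.prems(2)])+
qed

lemma Ck_on_bounded_linear:
  assumes "open U" "bounded_linear L" "Ck_on k U f"
  shows "Ck_on k U (\<lambda>x. L (f x))"
  using assms(3)
proof (induction k arbitrary: f)
  case 0
  then show ?case using assms(2) by (auto intro: bounded_linear.continuous_on)
next
  case (Suc k)
  show ?case
    by (rule Ck_on_Suc_I[OF \<open>open U\<close>],
        rule bounded_linear.has_derivative[OF assms(2) Ck_on_Suc_D(1)[OF Suc.prems]])
      (assumption | rule Suc.IH[OF Ck_on_Suc_D(2)[OF Suc.prems]])+
qed

lemma linear_expand_Basis:
  assumes "linear L"
  shows "L v = (\<Sum>b\<in>Basis. (v \<bullet> b) *\<^sub>R L b)"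
  by (subst euclidean_representation[of v, symmetric]) (simp only: linear_sum[OF assms] linear_scale[OF assms])

lemma Ck_on_compose:
  fixes f :: "'a::euclidean_space \<Rightarrow> 'b::euclidean_space"
  assumes "open U" "open V" "f ` U \<subseteq> V" "Ck_on k U f" "Ck_on k V g"
  shows "Ck_on k U (\<lambda>x. g (f x))"
  using assms(4,5)
proof (induction k arbitrary: g)
  case 0
  then show ?case using assms(3) by (auto intro: continuous_on_compose2)
next
  case (Suc k)
  let ?f' = "\<lambda>x. frechet_derivative f (at x)" and ?g' = "\<lambda>y. frechet_derivative g (at y)"
  \<comment> \<open>The chain rule feeds the direction \<open>?f' x v\<close>, which varies with
    \<open>x\<close>, to the derivative of \<open>g\<close>, whereas \<open>Ck_on\<close> controls
    fixed directions. Expanding over \<open>Basis\<close> moves the dependence into scalar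
    coefficients.\<close>
  have exp: "?g' (f x) (?f' x v) = (\<Sum>b\<in>Basis. (?f' x v \<bullet> b) *\<^sub>R ?g' (f x) b)" if "x \<in> U" for x v
    using that assms(3) Suc.prems(2) by (intro linear_expand_Basis linear_frechet_derivative) auto
  show ?case
  proof (rule Ck_on_Suc_I[OF \<open>open U\<close>])
    fix x assume "x \<in> U"
    then show "((\<lambda>x. g (f x)) has_derivative (\<lambda>v. ?g' (f x) (?f' x v))) (at x)"
      using assms(3) by (intro has_derivative_compose[OF Ck_on_Suc_D(1)[OF Suc.prems(1)]]
          Ck_on_Suc_D(1)[OF Suc.prems(2)]) auto
  next
    fix v
    have "Ck_on k U (\<lambda>x. \<Sum>b\<in>Basis. (?f' x v \<bullet> b) *\<^sub>R ?g' (f x) b)"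
      by (rule Ck_on_sum[OF \<open>open U\<close>], rule Ck_on_scaleR[OF \<open>open U\<close>
            Ck_on_bounded_linear[OF \<open>open U\<close> bounded_linear_inner_left Ck_on_Suc_D(2)[OF Suc.prems(1)]]
            Suc.IH[OF Ck_on_Suc_imp[OF Suc.prems(1)] Ck_on_Suc_D(2)[OF Suc.prems(2)]]])
    then show "Ck_on k U (\<lambda>x. ?g' (f x) (?f' x v))"
      by (subst Ck_on_cong[OF \<open>open U\<close> exp])
  qed
qed

lemma smooth_on_frechet_derivative:
  "smooth_on U f \<Longrightarrow> smooth_on U (\<lambda>x. frechet_derivative f (at x) v)"
  unfolding smooth_on_def by (metis Ck_on.simps(2))

lemma smooth_on_compose:
  fixes f :: "'a::euclidean_space \<Rightarrow> 'b::euclidean_space"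
  assumes "open U" "open V" "f ` U \<subseteq> V" "smooth_on U f" "smooth_on V g"
  shows "smooth_on U (\<lambda>x. g (f x))"
  using assms Ck_on_compose unfolding smooth_on_def by blast

lemma smooth_on_has_derivative:
  assumes "smooth_on U f" "x \<in> U"
  shows "(f has_derivative frechet_derivative f (at x)) (at x)"
  using assms Ck_on_Suc_D(1)[of 0 U f x] unfolding smooth_on_def by blast

subsection \<open>Submanifolds in a slice chart\<close>

text \<open>Difference quotients lie in \<open>W\<close>, and subspaces are closed in finite
  dimension. The derivative is taken within \<open>S\<close> because the curves in
  \<open>tangent_space\<close> are one-sided.\<close>

lemma has_vector_derivative_in_subspace:
  fixes f :: "real \<Rightarrow> 'a::euclidean_space"
  assumes f: "(f has_vector_derivative D) (at x within S)" and W: "subspace W"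
    and ev: "eventually (\<lambda>t. f t \<in> W) (at x within S)" and x: "f x \<in> W"
    and nt: "at x within S \<noteq> bot"
  shows "D \<in> W"
proof (rule Lim_in_closed_set)
  show "closed W" using W by (rule closed_subspace)
  show "((\<lambda>t. (1 / (t - x)) *\<^sub>R (f t - f x)) \<longlongrightarrow> D) (at x within S)"
  proof (rule LIM_zero_cancel, subst tendsto_norm_zero_iff[symmetric], rule Lim_transform_eventually)
    show "((\<lambda>t. norm ((f t - f x) - (t - x) *\<^sub>R D) / norm (t - x)) \<longlongrightarrow> 0) (at x within S)"
      using f unfolding has_vector_derivative_def has_derivative_iff_norm by blast
    show "\<forall>\<^sub>F t in at x within S. norm ((f t - f x) - (t - x) *\<^sub>R D) / norm (t - x) =
        norm ((1 / (t - x)) *\<^sub>R (f t - f x) - D)"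
    proof -
      have "norm ((f t - f x) - (t - x) *\<^sub>R D) / norm (t - x) =
          norm ((1 / (t - x)) *\<^sub>R (f t - f x) - D)" if "t \<noteq> x" for t
      proof -
        have "(1 / (t - x)) *\<^sub>R (f t - f x) - D = (1 / (t - x)) *\<^sub>R ((f t - f x) - (t - x) *\<^sub>R D)"
          using that by (simp add: scaleR_diff_right)
        then show ?thesis by simp
      qed
      then show ?thesis by (auto simp: eventually_at_filter)
    qed
  qed
  show "\<forall>\<^sub>F t in at x within S. (1 / (t - x)) *\<^sub>R (f t - f x) \<in> W"
    using ev by eventually_elim (intro subspace_scale[OF W] subspace_diff[OF W] x)
qed (use nt in simp)

section \<open>Normal components and their uniqueness\<close>

lemma normal_part_unique:
  assumes "subspace (tangent_space \<Sigma> p)" "w \<in> (tangent_space \<Sigma> p)\<^sup>\<bottom>" "x - w \<in> tangent_space \<Sigma> p"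
  shows "normal_part \<Sigma> p x = w"
  unfolding normal_part_def
proof (rule the_equality)
  fix w' assume w': "w' \<in> (tangent_space \<Sigma> p)\<^sup>\<bottom> \<and> x - w' \<in> tangent_space \<Sigma> p"
  let ?T = "tangent_space \<Sigma> p"
  have "w' - w \<in> ?T\<^sup>\<bottom>" using w' assms(2) by (simp add: subspace_diff subspace_orthogonal_comp)
  moreover have "w' - w \<in> ?T" 
    using subspace_diff[OF assms(1) assms(3), of "x - w'"] w' by simp
  ultimately have "(w' - w) \<bullet> (w' - w) = 0"
    by (auto simp: orthogonal_comp_def orthogonal_def)
  then show "w' = w" by simp
qed (use assms in auto)

lemma normal_part_props:
  assumes "subspace (tangent_space \<Sigma> p)"
  shows "normal_part \<Sigma> p x \<in> (tangent_space \<Sigma> p)\<^sup>\<bottom>" "x - normal_part \<Sigma> p x \<in> tangent_space \<Sigma> p"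
proof -
  obtain y z where "y \<in> tangent_space \<Sigma> p" "\<And>w. w \<in> tangent_space \<Sigma> p \<Longrightarrow> orthogonal z w" "x = y + z"
    using orthogonal_subspace_decomp_exists[of "tangent_space \<Sigma> p" x] assms span_eq_iff by metis
  moreover from this have "normal_part \<Sigma> p x = z"
    by (intro normal_part_unique[OF assms]) (auto simp: orthogonal_comp_def orthogonal_commute)
  ultimately show "normal_part \<Sigma> p x \<in> (tangent_space \<Sigma> p)\<^sup>\<bottom>" "x - normal_part \<Sigma> p x \<in> tangent_space \<Sigma> p"
    by (auto simp: orthogonal_comp_def orthogonal_commute)
qed

lemma normal_part_cong:
  assumes "subspace (tangent_space \<Sigma> p)" "x - y \<in> tangent_space \<Sigma> p"
  shows "normal_part \<Sigma> p x = normal_part \<Sigma> p y"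
proof (rule normal_part_unique[OF assms(1)])
  show "x - normal_part \<Sigma> p y \<in> tangent_space \<Sigma> p"
    using subspace_add[OF assms normal_part_props(2)[OF assms(1), of y]] by simp
qed (rule normal_part_props(1)[OF assms(1)])

lemma inner_normal_part:
  assumes "subspace (tangent_space \<Sigma> p)" "G \<in> (tangent_space \<Sigma> p)\<^sup>\<bottom>"
  shows "G \<bullet> normal_part \<Sigma> p x = G \<bullet> x"
  using normal_part_props(2)[OF assms(1), of x] assms(2)
  by (auto simp: orthogonal_comp_def orthogonal_def inner_diff_right inner_commute)

lemma has_vector_derivative_along_line:
  assumes "(f has_derivative f') (at (y + t *\<^sub>R u))"
  shows "((\<lambda>t. f (y + t *\<^sub>R u)) has_vector_derivative f' u) (at t)"
proof -
  have "((\<lambda>t. y + t *\<^sub>R u) has_derivative (\<lambda>h. h *\<^sub>R u)) (at t)"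
    by (auto intro!: derivative_eq_intros)
  from has_derivative_compose[OF this assms] linear_scale[OF has_derivative_linear[OF assms]]
  show ?thesis by (simp add: has_vector_derivative_def)
qed

text \<open>The chart of a point of \<open>manifold_interior\<close>. Half-space charts get no
  counterpart: every point at which the proof differentiates lies in an open ball that the boundary
  avoids.\<close>

locale slice_chart =
  fixes \<Sigma> U V W :: "'a::euclidean_space set" and \<phi> \<psi> :: "'a \<Rightarrow> 'a"
  assumes diffeo: "diffeomorphism U V \<phi> \<psi>" and W: "subspace W"
    and chart: "\<phi> ` (\<Sigma> \<inter> U) = V \<inter> W"
begin

abbreviation D\<phi> where "D\<phi> x \<equiv> frechet_derivative \<phi> (at x)"
abbreviation D\<psi> where "D\<psi> y \<equiv> frechet_derivative \<psi> (at y)"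

lemma open_U: "open U" and open_V: "open V"
  and smooth_\<phi>: "smooth_on U \<phi>" and smooth_\<psi>: "smooth_on V \<psi>"
  using diffeo by (auto simp: diffeomorphism_def)

lemma \<phi>_in_V: "x \<in> U \<Longrightarrow> \<phi> x \<in> V" and \<psi>_in_U: "y \<in> V \<Longrightarrow> \<psi> y \<in> U"
  and \<psi>_\<phi>: "x \<in> U \<Longrightarrow> \<psi> (\<phi> x) = x" and \<phi>_\<psi>: "y \<in> V \<Longrightarrow> \<phi> (\<psi> y) = y"
  using diffeo by (auto simp: diffeomorphism_def homeomorphism_def)

lemma \<phi>_in_W: "x \<in> \<Sigma> \<Longrightarrow> x \<in> U \<Longrightarrow> \<phi> x \<in> W"
  using chart by blast

lemma \<psi>_in_\<Sigma>:
  assumes "y \<in> V" "y \<in> W"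
  shows "\<psi> y \<in> \<Sigma>"
proof -
  obtain x where "x \<in> \<Sigma> \<inter> U" "y = \<phi> x" using assms chart by blast
  then show ?thesis using \<psi>_\<phi> by simp
qed

lemmas D\<phi> = smooth_on_has_derivative[OF smooth_\<phi>]
lemmas D\<psi> = smooth_on_has_derivative[OF smooth_\<psi>]

lemma D\<psi>_D\<phi>:
  assumes "x \<in> U"
  shows "D\<psi> (\<phi> x) (D\<phi> x v) = v"
proof -
  have "((\<lambda>x. \<psi> (\<phi> x)) has_derivative (\<lambda>v. D\<psi> (\<phi> x) (D\<phi> x v))) (at x)"
    by (rule has_derivative_compose[OF D\<phi>[OF assms] D\<psi>[OF \<phi>_in_V[OF assms]]])
  then have "((\<lambda>x. x) has_derivative (\<lambda>v. D\<psi> (\<phi> x) (D\<phi> x v))) (at x)"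
    by (rule has_derivative_transform_within_open[OF _ open_U assms]) (rule \<psi>_\<phi>)
  from has_derivative_unique[OF this has_derivative_ident] show ?thesis by metis
qed

lemma D\<phi>_D\<psi>:
  assumes "x \<in> U"
  shows "D\<phi> x (D\<psi> (\<phi> x) w) = w"
proof -
  have x: "((\<lambda>y. \<phi> (\<psi> y)) has_derivative (\<lambda>w. D\<phi> x (D\<psi> (\<phi> x) w))) (at (\<phi> x))"
    by (rule has_derivative_compose[OF D\<psi>[OF \<phi>_in_V[OF assms]], of \<phi> "D\<phi> x", unfolded \<psi>_\<phi>[OF assms], OF D\<phi>[OF assms]])
  then have "((\<lambda>x. x) has_derivative (\<lambda>w. D\<phi> x (D\<psi> (\<phi> x) w))) (at (\<phi> x))"
    by (rule has_derivative_transform_within_open[OF _ open_V \<phi>_in_V[OF assms]]) (rule \<phi>_\<psi>)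
  from has_derivative_unique[OF this has_derivative_ident] show ?thesis by metis
qed

lemma line_in_V:
  assumes "y \<in> V"
  shows "\<exists>\<epsilon>>0. \<forall>t. \<bar>t\<bar> < \<epsilon> \<longrightarrow> y + t *\<^sub>R u \<in> V"
proof -
  have "open ((\<lambda>t. y + t *\<^sub>R u) -` V)"
    by (intro open_vimage open_V continuous_intros)
  moreover have "0 \<in> (\<lambda>t. y + t *\<^sub>R u) -` V" using assms by simp
  ultimately obtain \<epsilon> where "\<epsilon> > 0" "ball 0 \<epsilon> \<subseteq> (\<lambda>t. y + t *\<^sub>R u) -` V"
    using open_contains_ball by metis
  then show ?thesis by (auto simp: subset_iff)
qed

text \<open>The set of velocities is itself a subspace. Read in the chart, a velocity is a limit of
  difference quotients in \<open>W\<close>; conversely, each direction in \<open>W\<close> is the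
  velocity of a straight segment that \<open>\<psi>\<close> carries into
  \<open>\<Sigma>\<close>.\<close>

lemma tangent_space_eq:
  assumes "q \<in> \<Sigma>" "q \<in> U"
  shows "tangent_space \<Sigma> q = D\<psi> (\<phi> q) ` W"
proof -
  let ?S = "{v. \<exists>\<gamma> \<epsilon>. 0 < \<epsilon> \<and> \<gamma> 0 = q \<and> \<gamma> ` {0..\<epsilon>} \<subseteq> \<Sigma> \<and>
     (\<gamma> has_vector_derivative v) (at 0 within {0..\<epsilon>})}"
  have sub: "subspace (D\<psi> (\<phi> q) ` W)"
    by (intro linear_subspace_image W has_derivative_linear[OF D\<psi>[OF \<phi>_in_V[OF assms(2)]]])
  have "v \<in> D\<psi> (\<phi> q) ` W" if "v \<in> ?S" for v
  proof -
    from that obtain \<gamma> \<epsilon> where \<epsilon>: "0 < \<epsilon>" and \<gamma>: "\<gamma> 0 = q" "\<gamma> ` {0..\<epsilon>} \<subseteq> \<Sigma>"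
      and d: "(\<gamma> has_vector_derivative v) (at 0 within {0..\<epsilon>})" by blast
    have dd: "((\<lambda>t. \<phi> (\<gamma> t)) has_vector_derivative D\<phi> q v) (at 0 within {0..\<epsilon>})"
      using has_derivative_compose[OF d[unfolded has_vector_derivative_def], of \<phi> "D\<phi> q"] D\<phi>[OF assms(2)] \<gamma>(1)
        linear_scale[OF has_derivative_linear[OF D\<phi>[OF assms(2)]]]
      by (simp add: has_vector_derivative_def)
    have "\<forall>\<^sub>F t in at 0 within {0..\<epsilon>}. \<gamma> t \<in> U"
      using has_vector_derivative_continuous[OF d] open_U assms(2) \<gamma>(1)
      by (simp add: continuous_within topological_tendstoD)
    then have "\<forall>\<^sub>F t in at 0 within {0..\<epsilon>}. \<phi> (\<gamma> t) \<in> W"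
      unfolding eventually_at_filter by (rule eventually_mono) (use \<gamma>(2) \<phi>_in_W in blast)
    then have "D\<phi> q v \<in> W"
      by (rule has_vector_derivative_in_subspace[OF dd W]) (use \<epsilon> \<phi>_in_W assms \<gamma> in \<open>auto simp: trivial_limit_within islimpt_Icc\<close>)
    then show ?thesis using D\<psi>_D\<phi>[OF assms(2), of v] by (metis image_eqI)
  qed
  moreover have "D\<psi> (\<phi> q) u \<in> ?S" if u: "u \<in> W" for u
  proof -
    obtain \<epsilon> where \<epsilon>: "\<epsilon> > 0" "\<And>t. \<bar>t\<bar> < \<epsilon> \<Longrightarrow> \<phi> q + t *\<^sub>R u \<in> V"
      using line_in_V[OF \<phi>_in_V[OF assms(2)]] by blast
    have "\<psi> (\<phi> q + t *\<^sub>R u) \<in> \<Sigma>" if "\<bar>t\<bar> < \<epsilon>" for t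
      by (intro \<psi>_in_\<Sigma> \<epsilon> that subspace_add[OF W] subspace_scale[OF W] u \<phi>_in_W assms)
    moreover have "((\<lambda>t. \<psi> (\<phi> q + t *\<^sub>R u)) has_vector_derivative D\<psi> (\<phi> q) u) (at 0 within {0..\<epsilon>/2})"
      by (rule has_vector_derivative_at_within,
          rule has_vector_derivative_along_line[where t = 0 and y = "\<phi> q", unfolded scaleR_zero_left add_0_right])
        (rule D\<psi>[OF \<phi>_in_V[OF assms(2)]])
    ultimately show ?thesis using \<epsilon>(1) \<psi>_\<phi>[OF assms(2)]
      by (intro CollectI exI[of _ "\<lambda>t. \<psi> (\<phi> q + t *\<^sub>R u)"] exI[of _ "\<epsilon>/2"]) auto
  qed
  ultimately have "?S = D\<psi> (\<phi> q) ` W" by blast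
  then show ?thesis unfolding tangent_space_def using sub span_eq_iff by metis
qed

lemma dim_tangent_space:
  assumes "q \<in> \<Sigma>" "q \<in> U"
  shows "dim (tangent_space \<Sigma> q) = dim W"
proof -
  have "inj (D\<psi> (\<phi> q))"
    by (rule inj_on_inverseI[of _ "D\<phi> q"]) (rule D\<phi>_D\<psi>[OF assms(2)])
  then show ?thesis
    unfolding tangent_space_eq[OF assms]
    by (intro dim_image_eq has_derivative_linear[OF D\<psi>[OF \<phi>_in_V[OF assms(2)]]]) (auto intro: inj_on_subset)
qed

text \<open>The second derivative of \<open>\<psi>\<close> at \<open>\<phi> p\<close>, applied to
  the chart images of \<open>v\<close> and \<open>w\<close>. On the diagonal it is the acceleration
  of the curve that is a straight line in the chart. Its tangential part depends on the chart; its
  normal part turns out to be the second fundamental form.\<close>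

definition slice_acceleration :: "'a \<Rightarrow> 'a \<Rightarrow> 'a \<Rightarrow> 'a" where
  "slice_acceleration p v w = frechet_derivative (\<lambda>y. D\<psi> y (D\<phi> p v)) (at (\<phi> p)) (D\<phi> p w)"

lemma D2\<psi>:
  assumes "y \<in> V"
  shows "((\<lambda>y. D\<psi> y u) has_derivative frechet_derivative (\<lambda>y. D\<psi> y u) (at y)) (at y)"
  using smooth_on_has_derivative[OF smooth_on_frechet_derivative[OF smooth_\<psi>] assms] .

lemma bilinear_slice_acceleration:
  assumes p: "p \<in> U"
  shows "bilinear (slice_acceleration p)"
proof -
  note y = \<phi>_in_V[OF p]
  note lin = has_derivative_linear[OF D\<phi>[OF p]]
  let ?H = "\<lambda>a. frechet_derivative (\<lambda>y. D\<psi> y a) (at (\<phi> p))"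
  have lin\<psi>: "linear (D\<psi> y)" if "y \<in> V" for y by (rule has_derivative_linear[OF D\<psi>[OF that]])
  \<comment> \<open>Linearity in the first slot comes from \<open>D\<psi> y\<close> being linear for
    all \<open>y\<close> in \<open>V\<close>, by uniqueness of derivatives.\<close>
  have "?H (a + b) = (\<lambda>w. ?H a w + ?H b w)" for a b
    by (rule frechet_derivative_at[symmetric],
        rule has_derivative_transform_within_open[OF has_derivative_add[OF D2\<psi>[OF y] D2\<psi>[OF y]] open_V y])
      (simp add: linear_add[OF lin\<psi>])
  moreover have "?H (c *\<^sub>R a) = (\<lambda>w. c *\<^sub>R ?H a w)" for c a
    by (rule frechet_derivative_at[symmetric],
        rule has_derivative_transform_within_open[OF has_derivative_scaleR_right[OF D2\<psi>[OF y]] open_V y])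
      (simp add: linear_scale[OF lin\<psi>])
  ultimately have "linear (\<lambda>v. slice_acceleration p v w)" for w
    by (intro linearI) (simp_all add: slice_acceleration_def linear_add[OF lin] linear_scale[OF lin])
  moreover have "linear (slice_acceleration p v)" for v
    using linear_compose[OF lin has_derivative_linear[OF D2\<psi>[OF y]]]
    by (simp add: slice_acceleration_def[abs_def] o_def)
  ultimately show ?thesis by (simp add: bilinear_def)
qed

lemma tangent_curve:
  assumes "p \<in> \<Sigma>" "p \<in> U" "v \<in> tangent_space \<Sigma> p"
  obtains \<gamma> \<gamma>' \<epsilon> where "\<epsilon> > 0" "\<gamma> 0 = p" "\<gamma>' 0 = v"
    "\<And>t. \<bar>t\<bar> < \<epsilon> \<Longrightarrow> \<gamma> t \<in> \<Sigma> \<inter> U"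
    "\<And>t. \<bar>t\<bar> < \<epsilon> \<Longrightarrow> (\<gamma> has_vector_derivative \<gamma>' t) (at t)"
    "(\<gamma>' has_vector_derivative slice_acceleration p v v) (at 0)"
proof -
  let ?u = "D\<phi> p v"
  let ?l = "\<lambda>t. \<phi> p + t *\<^sub>R ?u"
  note y = \<phi>_in_V[OF assms(2)]
  obtain u where "u \<in> W" "v = D\<psi> (\<phi> p) u"
    using assms(3) tangent_space_eq[OF assms(1,2)] by blast
  then have u: "?u \<in> W" using D\<phi>_D\<psi>[OF assms(2)] by simp
  obtain \<epsilon> where \<epsilon>: "\<epsilon> > 0" "\<And>t. \<bar>t\<bar> < \<epsilon> \<Longrightarrow> ?l t \<in> V"
    using line_in_V[OF y] by blast
  show ?thesis
  proof (rule that[OF \<epsilon>(1), of "\<lambda>t. \<psi> (?l t)" "\<lambda>t. D\<psi> (?l t) ?u"])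
    show "\<psi> (?l 0) = p" "D\<psi> (?l 0) ?u = v"
      using \<psi>_\<phi>[OF assms(2)] D\<psi>_D\<phi>[OF assms(2)] by simp_all
    fix t :: real assume "\<bar>t\<bar> < \<epsilon>"
    note t = \<epsilon>(2)[OF this]
    show "\<psi> (?l t) \<in> \<Sigma> \<inter> U"
      by (intro IntI \<psi>_in_\<Sigma> \<psi>_in_U t subspace_add[OF W] subspace_scale[OF W] u \<phi>_in_W assms)
    show "((\<lambda>t. \<psi> (?l t)) has_vector_derivative D\<psi> (?l t) ?u) (at t)"
      by (rule has_vector_derivative_along_line[OF D\<psi>[OF t]])
  next
    show "((\<lambda>t. D\<psi> (?l t) ?u) has_vector_derivative slice_acceleration p v v) (at 0)"
      unfolding slice_acceleration_def
      by (rule has_vector_derivative_along_line[where t = 0 and y = "\<phi> p", unfolded scaleR_zero_left add_0_right,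
            OF D2\<psi>[OF y]])
  qed
qed

text \<open>Applied to the difference of two tangent fields that agree at \<open>p\<close>. Read in
  the chart, \<open>Z\<close> takes values in \<open>W\<close> along \<open>\<Sigma>\<close>, so its
  derivative along a curve in \<open>\<Sigma>\<close> stays in \<open>W\<close>;
  \<open>Z p = 0\<close> kills the term in which the chart itself is differentiated.\<close>

lemma vanishing_tangent_field_derivative:
  assumes p: "p \<in> \<Sigma>" "p \<in> U" and v: "v \<in> tangent_space \<Sigma> p"
    and S: "open S" "p \<in> S" and tan: "\<And>q. q \<in> \<Sigma> \<inter> S \<Longrightarrow> Z q \<in> tangent_space \<Sigma> q"
    and Z: "(Z has_derivative Z') (at p)" and 0: "Z p = 0"
  shows "Z' v \<in> tangent_space \<Sigma> p"
proof -
  obtain \<gamma> \<gamma>' \<epsilon> where \<epsilon>: "\<epsilon> > 0" and \<gamma>: "\<gamma> 0 = p" "\<gamma>' 0 = v"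
    "\<And>t. \<bar>t\<bar> < \<epsilon> \<Longrightarrow> \<gamma> t \<in> \<Sigma> \<inter> U"
    "\<And>t. \<bar>t\<bar> < \<epsilon> \<Longrightarrow> (\<gamma> has_vector_derivative \<gamma>' t) (at t)"
    using tangent_curve[OF p v] by metis
  \<comment> \<open>The field \<open>Z\<close> read in the chart, expanded over \<open>Basis\<close>
    so that the product rule meets fixed directions.\<close>
  define h where "h x = (\<Sum>b\<in>Basis. (Z x \<bullet> b) *\<^sub>R D\<phi> x b)" for x
  have h_eq: "h x = D\<phi> x (Z x)" if "x \<in> U" for x
    unfolding h_def by (rule linear_expand_Basis[symmetric, OF has_derivative_linear[OF D\<phi>[OF that]]])
  have D2\<phi>: "((\<lambda>x. D\<phi> x b) has_derivative frechet_derivative (\<lambda>x. D\<phi> x b) (at p)) (at p)" for b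
    using smooth_on_has_derivative[OF smooth_on_frechet_derivative[OF smooth_\<phi>] p(2)] .
  have "(h has_derivative (\<lambda>w. \<Sum>b\<in>Basis. (Z' w \<bullet> b) *\<^sub>R D\<phi> p b)) (at p)"
    unfolding h_def
    by (rule derivative_eq_intros Z D2\<phi> refl)+ (simp add: 0)
  then have h': "(h has_derivative (\<lambda>w. D\<phi> p (Z' w))) (at p)"
    by (simp only: linear_expand_Basis[OF has_derivative_linear[OF D\<phi>[OF p(2)]], symmetric])
  have \<gamma>0: "(\<gamma> has_vector_derivative v) (at 0)" using \<gamma>(2) \<gamma>(4)[of 0] \<epsilon> by simp
  have "((\<lambda>t. h (\<gamma> t)) has_vector_derivative D\<phi> p (Z' v)) (at 0)"
    using has_derivative_compose[OF \<gamma>0[unfolded has_vector_derivative_def], of h "\<lambda>w. D\<phi> p (Z' w)"] h'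
      linear_scale[OF has_derivative_linear[OF h']] \<gamma>(1)
    by (simp add: has_vector_derivative_def)
  moreover have "\<forall>\<^sub>F t in at 0. h (\<gamma> t) \<in> W"
  proof -
    have "\<forall>\<^sub>F t in at 0. \<gamma> t \<in> S"
      using has_vector_derivative_continuous[OF \<gamma>0] S \<gamma>(1)
      by (simp add: continuous_within topological_tendstoD)
    moreover have "\<forall>\<^sub>F t in at 0. \<gamma> t \<in> \<Sigma> \<inter> U"
      unfolding eventually_at using \<epsilon> \<gamma>(3) by (intro exI[of _ \<epsilon>]) auto
    ultimately show ?thesis
    proof eventually_elim
      case (elim t)
      then have "Z (\<gamma> t) \<in> D\<psi> (\<phi> (\<gamma> t)) ` W" using tan tangent_space_eq by blast
      then show ?case using elim h_eq D\<phi>_D\<psi> by auto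
    qed
  qed
  moreover have "h (\<gamma> 0) \<in> W" by (simp add: \<gamma>(1) h_def 0 subspace_0[OF W])
  ultimately have "D\<phi> p (Z' v) \<in> W"
    by (rule has_vector_derivative_in_subspace[OF _ W]) simp
  then show ?thesis
    unfolding tangent_space_eq[OF p] using D\<psi>_D\<phi>[OF p(2), of "Z' v"] by (metis image_eqI)
qed

text \<open>Here the definite description becomes well defined: an explicit field gives existence,
  and any two admissible fields differ by one that vanishes at \<open>p\<close>. The diagonal is
  what the trace in \<open>mean_curvature\<close> asks for.\<close>

lemma second_fundamental_form_eq:
  assumes p: "p \<in> \<Sigma>" "p \<in> U" and v: "v \<in> tangent_space \<Sigma> p"
  shows "second_fundamental_form \<Sigma> p v v = normal_part \<Sigma> p (slice_acceleration p v v)"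
proof -
  let ?T = "tangent_space \<Sigma> p"
  note y = \<phi>_in_V[OF p(2)]
  have T: "subspace ?T" by (simp add: tangent_space_def)
  \<comment> \<open>The push-forward under \<open>\<psi>\<close> of the constant field
    \<open>D\<phi> p v\<close>; it is tangent because this vector lies in \<open>W\<close>.\<close>
  define Y where "Y x = D\<psi> (\<phi> x) (D\<phi> p v)" for x
  have u: "D\<phi> p v \<in> W"
    using v tangent_space_eq[OF p] D\<phi>_D\<psi>[OF p(2)] by auto
  have smooth: "smooth_on U Y"
    unfolding Y_def using \<phi>_in_V
    by (intro smooth_on_compose[OF open_U open_V _ smooth_\<phi> smooth_on_frechet_derivative[OF smooth_\<psi>]]) auto
  have tan: "Y q \<in> tangent_space \<Sigma> q" if "q \<in> \<Sigma> \<inter> U" for q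
    using that tangent_space_eq[of q] u by (simp add: Y_def)
  have Yp: "Y p = v" by (simp add: Y_def D\<psi>_D\<phi>[OF p(2)])
  have "(Y has_derivative slice_acceleration p v) (at p)"
    unfolding Y_def slice_acceleration_def by (rule has_derivative_compose[OF D\<phi>[OF p(2)] D2\<psi>[OF y]])
  then have DY: "frechet_derivative Y (at p) = slice_acceleration p v"
    using frechet_derivative_at by metis
  show ?thesis
    unfolding second_fundamental_form_def
  proof (rule the_equality)
    show "\<exists>Y. tangent_field_near \<Sigma> p Y \<and> Y p = v \<and>
        normal_part \<Sigma> p (slice_acceleration p v v) = normal_part \<Sigma> p (frechet_derivative Y (at p) v)"
      using open_U p(2) smooth tan Yp DY unfolding tangent_field_near_def by metis
  next
    fix w assume "\<exists>X. tangent_field_near \<Sigma> p X \<and> X p = v \<and>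
        w = normal_part \<Sigma> p (frechet_derivative X (at p) v)"
    then obtain X S where S: "open S" "p \<in> S" "smooth_on S X" "\<And>q. q \<in> \<Sigma> \<inter> S \<Longrightarrow> X q \<in> tangent_space \<Sigma> q"
      and X: "X p = v" and w: "w = normal_part \<Sigma> p (frechet_derivative X (at p) v)"
      unfolding tangent_field_near_def by blast
    have "frechet_derivative X (at p) v - frechet_derivative Y (at p) v \<in> ?T"
    proof (rule vanishing_tangent_field_derivative[OF p v])
      show "open (S \<inter> U)" "p \<in> S \<inter> U" using S open_U p by auto
      show "((\<lambda>q. X q - Y q) has_derivative
          (\<lambda>v. frechet_derivative X (at p) v - frechet_derivative Y (at p) v)) (at p)"
        by (intro has_derivative_diff smooth_on_has_derivative[OF S(3,2)] smooth_on_has_derivative[OF smooth p(2)])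
      show "X q - Y q \<in> tangent_space \<Sigma> q" if "q \<in> \<Sigma> \<inter> (S \<inter> U)" for q
        using that S(4)[of q] tan[of q] unfolding tangent_space_def by (simp add: span_diff)
    qed (simp add: X Yp)
    then show "w = normal_part \<Sigma> p (slice_acceleration p v v)"
      unfolding w using normal_part_cong[OF T] DY by simp
  qed
qed

end

subsection \<open>Orthonormal bases of hyperplanes and traces\<close>

lemma orthonormal_basis_of_properties:
  fixes B :: "'a::euclidean_space set"
  assumes "orthonormal_basis_of T B"
  shows "finite B" "card B = dim T" "B \<subseteq> T" "subspace T"
    and "\<And>b c. b \<in> B \<Longrightarrow> c \<in> B \<Longrightarrow> b \<bullet> c = (if b = c then 1 else 0)"
    and "\<And>x. x \<in> T \<Longrightarrow> (\<Sum>b\<in>B. (x \<bullet> b) *\<^sub>R b) = x"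
proof -
  have B: "pairwise orthogonal B" "\<And>b. b \<in> B \<Longrightarrow> norm b = 1" "span B = T"
    using assms by (auto simp: orthonormal_basis_of_def)
  then have ind: "independent B" using pairwise_orthogonal_independent by force
  then show "finite B" by (rule independent_imp_finite)
  show "card B = dim T" using dim_eq_card_independent[OF ind] B(3) dim_span by metis
  show "B \<subseteq> T" "subspace T" using B(3) span_superset by auto
  show "b \<bullet> c = (if b = c then 1 else 0)" if "b \<in> B" "c \<in> B" for b c
    using that B(1,2) by (auto simp: pairwise_def orthogonal_def dot_square_norm)
  show "(\<Sum>b\<in>B. (x \<bullet> b) *\<^sub>R b) = x" if "x \<in> T" for x
    using orthonormal_basis_expand[OF B(1,2) _ \<open>finite B\<close>] that B(3) by blast
qed

lemma parseval_orthonormal_basis_of: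
  fixes B :: "'a::euclidean_space set"
  assumes "orthonormal_basis_of T B" "x \<in> T"
  shows "(\<Sum>b\<in>B. (x \<bullet> b) * (y \<bullet> b)) = x \<bullet> y"
proof -
  have "x \<bullet> y = (\<Sum>b\<in>B. (x \<bullet> b) *\<^sub>R b) \<bullet> y"
    using orthonormal_basis_of_properties(6)[OF assms] by simp
  then show ?thesis by (simp add: inner_sum_left inner_commute[of y])
qed

text \<open>Expand each \<open>b\<close> in \<open>C\<close>; by Parseval for \<open>B\<close> the
  coefficients of \<open>f c c'\<close> sum to \<open>c \<bullet> c'\<close>. This trades the basis
  that \<open>mean_curvature\<close> picks by \<open>SOME\<close> for any basis at hand.\<close>

lemma trace_orthonormal_basis_of:
  fixes f :: "'a::euclidean_space \<Rightarrow> 'a \<Rightarrow> 'b::real_vector"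
  assumes f: "bilinear f" and B: "orthonormal_basis_of T B" and C: "orthonormal_basis_of T C"
  shows "(\<Sum>b\<in>B. f b b) = (\<Sum>c\<in>C. f c c)"
proof -
  note b = orthonormal_basis_of_properties[OF B] and c = orthonormal_basis_of_properties[OF C]
  have "f b b = (\<Sum>(c, c')\<in>C\<times>C. ((b \<bullet> c) * (b \<bullet> c')) *\<^sub>R f c c')" if "b \<in> B" for b
  proof -
    have "b = (\<Sum>c\<in>C. (b \<bullet> c) *\<^sub>R c)" using c(6) that b(3) by force
    then have "f b b = f (\<Sum>c\<in>C. (b \<bullet> c) *\<^sub>R c) (\<Sum>c\<in>C. (b \<bullet> c) *\<^sub>R c)" by simp
    also have "\<dots> = (\<Sum>(c, c')\<in>C\<times>C. f ((b \<bullet> c) *\<^sub>R c) ((b \<bullet> c') *\<^sub>R c'))"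
      by (rule bilinear_sum[OF f])
    finally show ?thesis by (simp add: bilinear_lmul[OF f] bilinear_rmul[OF f] mult.commute)
  qed
  then have "(\<Sum>b\<in>B. f b b) = (\<Sum>b\<in>B. \<Sum>(c, c')\<in>C\<times>C. ((b \<bullet> c) * (b \<bullet> c')) *\<^sub>R f c c')"
    by (rule sum.cong[OF refl])
  also have "\<dots> = (\<Sum>(c, c')\<in>C\<times>C. (\<Sum>b\<in>B. (c \<bullet> b) * (c' \<bullet> b)) *\<^sub>R f c c')"
    by (subst sum.swap) (simp add: case_prod_unfold scaleR_sum_left inner_commute)
  also have "\<dots> = (\<Sum>(c, c')\<in>C\<times>C. (if c = c' then 1 else 0) *\<^sub>R f c c')"
    using c(3,5) by (intro sum.cong) (auto simp: parseval_orthonormal_basis_of[OF B] subset_iff)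
  also have "\<dots> = (\<Sum>c\<in>C. \<Sum>c'\<in>C. if c = c' then f c c' else 0)"
    unfolding sum.cartesian_product by (intro sum.cong) auto
  also have "\<dots> = (\<Sum>c\<in>C. f c c)" using c(1) by simp
  finally show ?thesis .
qed

subsection \<open>Second variation at interior points of shrinkers\<close>

text \<open>Second-order data of a curve in \<open>\<Sigma>\<close>, with the chart forgotten. The
  second derivative is asked for at \<open>0\<close> only, as in the second derivative test
  below.\<close>

definition two_jet :: "'a::real_normed_vector set \<Rightarrow> 'a \<Rightarrow> 'a \<Rightarrow> 'a \<Rightarrow> bool" where
  "two_jet \<Sigma> p v a \<longleftrightarrow> (\<exists>\<gamma> \<gamma>' \<epsilon>. \<epsilon> > 0 \<and> \<gamma> 0 = p \<and> \<gamma>' 0 = v \<and> (\<forall>t. \<bar>t\<bar> < \<epsilon> \<longrightarrow> \<gamma> t \<in> \<Sigma>) \<and>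
     (\<forall>t. \<bar>t\<bar> < \<epsilon> \<longrightarrow> (\<gamma> has_vector_derivative \<gamma>' t) (at t)) \<and>
     (\<gamma>' has_vector_derivative a) (at 0))"

text \<open>All that the later arguments know about a shrinker. A normal \<open>G\<close> sees only
  the normal part of the acceleration, that is, the second fundamental form, whose trace is minus
  the mean curvature and hence minus half the normal part of \<open>p\<close>.\<close>

lemma shrinker_interior_expansion:
  fixes \<Sigma> :: "'a::euclidean_space set"
  assumes "shrinker d \<Sigma>" "p \<in> manifold_interior d \<Sigma>"
  obtains \<beta> where "subspace (tangent_space \<Sigma> p)" "dim (tangent_space \<Sigma> p) = d"
    "\<And>v. v \<in> tangent_space \<Sigma> p \<Longrightarrow> two_jet \<Sigma> p v (\<beta> v v)"
    "\<And>G B. G \<in> (tangent_space \<Sigma> p)\<^sup>\<bottom> \<Longrightarrow> orthonormal_basis_of (tangent_space \<Sigma> p) B \<Longrightarrow>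
       (\<Sum>b\<in>B. G \<bullet> \<beta> b b) = - (G \<bullet> p) / 2"
proof -
  let ?T = "tangent_space \<Sigma> p"
  obtain U V \<phi> \<psi> W where "diffeomorphism U V \<phi> \<psi>" "p \<in> U" "subspace W" "dim W = d" "\<phi> ` (\<Sigma> \<inter> U) = V \<inter> W"
    and p: "p \<in> \<Sigma>"
    using assms(2) unfolding manifold_interior_def by blast
  then interpret slice_chart \<Sigma> U V W \<phi> \<psi> by unfold_locales
  have pU: "p \<in> U" by fact
  have T: "subspace ?T" by (simp add: tangent_space_def)
  show ?thesis
  proof (rule that[OF T])
    show "dim ?T = d" using dim_tangent_space[OF p pU] \<open>dim W = d\<close> by simp
  next
    fix v assume "v \<in> ?T"
    from tangent_curve[OF p pU this]
    show "two_jet \<Sigma> p v (slice_acceleration p v v)"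
      unfolding two_jet_def by (metis IntD1)
  next
    fix G C assume G: "G \<in> ?T\<^sup>\<bottom>" and C: "orthonormal_basis_of ?T C"
    \<comment> \<open>The very basis selected inside \<open>mean_curvature\<close>; the trace is
      carried over to \<open>C\<close> at the end.\<close>
    define B where "B = (SOME B. orthonormal_basis_of ?T B)"
    have "\<exists>B. orthonormal_basis_of ?T B"
      using orthonormal_basis_subspace[OF T] unfolding orthonormal_basis_of_def by metis
    then have B: "orthonormal_basis_of ?T B" unfolding B_def by (rule someI_ex)
    have "b \<in> ?T" if "b \<in> B" for b
      using B that unfolding orthonormal_basis_of_def by (metis span_base)
    then have "(\<Sum>b\<in>B. G \<bullet> slice_acceleration p b b) = G \<bullet> (\<Sum>b\<in>B. second_fundamental_form \<Sigma> p b b)"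
      unfolding inner_sum_right
      by (intro sum.cong) (simp_all add: second_fundamental_form_eq[OF p pU] inner_normal_part[OF T G])
    also have "(\<Sum>b\<in>B. second_fundamental_form \<Sigma> p b b) = - mean_curvature \<Sigma> p"
      by (simp add: mean_curvature_def B_def)
    also have "mean_curvature \<Sigma> p = (1/2) *\<^sub>R normal_part \<Sigma> p p"
      using assms(1) p unfolding shrinker_def by blast
    also have "G \<bullet> (- ((1/2) *\<^sub>R normal_part \<Sigma> p p)) = - (G \<bullet> p) / 2"
      by (simp add: inner_normal_part[OF T G])
    finally show "(\<Sum>b\<in>C. G \<bullet> slice_acceleration p b b) = - (G \<bullet> p) / 2"
      unfolding inner_sum_right[symmetric]
        trace_orthonormal_basis_of[OF bilinear_slice_acceleration[OF pU] C B] .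
  qed
qed

text \<open>If \<open>D < 0\<close>, then \<open>f'\<close> is negative just to the right of
  \<open>0\<close>, so \<open>f\<close> decreases there, against minimality.\<close>

lemma local_min_second_derivative:
  fixes f :: "real \<Rightarrow> real"
  assumes \<epsilon>: "\<epsilon> > 0" and f: "\<And>t. \<bar>t\<bar> < \<epsilon> \<Longrightarrow> DERIV f t :> f' t" and f': "DERIV f' 0 :> D"
    and min: "\<And>t. \<bar>t\<bar> < \<epsilon> \<Longrightarrow> f 0 \<le> f t"
  shows "f' 0 = 0" "D \<ge> 0"
proof -
  show 0: "f' 0 = 0"
    using f[of 0] \<epsilon> min by (intro DERIV_local_min[of f _ 0 \<epsilon>]) auto
  show "D \<ge> 0"
  proof (rule ccontr)
    assume "\<not> D \<ge> 0"
    with DERIV_neg_dec_right[OF f'] 0 obtain d where d: "d > 0" "\<And>h. 0 < h \<Longrightarrow> h < d \<Longrightarrow> f' h < 0"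
      by auto
    define t where "t = min d \<epsilon> / 2"
    have t: "0 < t" "t < d" "t < \<epsilon>" using d(1) \<epsilon> by (auto simp: t_def)
    have "f t < f 0"
    proof (rule DERIV_neg_imp_decreasing_open[OF t(1)])
      show "\<exists>y. DERIV f x :> y \<and> y < 0" if "0 < x" "x < t" for x
        using that t f[of x] d(2)[of x] by force
      show "continuous_on {0..t} f"
        using t by (intro continuous_at_imp_continuous_on ballI DERIV_isCont[OF f]) auto
    qed
    with min[of t] t show False by simp
  qed
qed

text \<open>Take the point closest to the origin. The first variation of |x|^2 makes
  \<open>p\<close> normal; half the second variation, summed over an orthonormal basis, gives 0
  \<le> d - |p|^2 / 2.\<close>

lemma shrinker_point_near_origin:
  fixes \<Sigma> :: "'a::euclidean_space set"
  assumes "shrinker d \<Sigma>" "compact \<Sigma>" "\<Sigma> \<inter> ball 0 R \<noteq> {}"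
    and int: "\<Sigma> \<inter> ball 0 R \<subseteq> manifold_interior d \<Sigma>"
  obtains p where "p \<in> \<Sigma>" "p \<bullet> p \<le> 2 * d"
proof -
  obtain p where p: "p \<in> \<Sigma>" and min: "\<And>x. x \<in> \<Sigma> \<Longrightarrow> norm p \<le> norm x"
    using continuous_attains_inf[of \<Sigma> norm] assms(2,3) continuous_on_norm_id by blast
  obtain x where "x \<in> \<Sigma>" "norm x < R" using assms(3) by auto
  then have int_p: "p \<in> manifold_interior d \<Sigma>" using int p min[of x] by auto
  let ?T = "tangent_space \<Sigma> p"
  from shrinker_interior_expansion[OF assms(1) int_p] obtain \<beta> where T: "subspace ?T" "dim ?T = d"
    and curve: "\<And>v. v \<in> ?T \<Longrightarrow> two_jet \<Sigma> p v (\<beta> v v)"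
    and trace: "\<And>G B. G \<in> ?T\<^sup>\<bottom> \<Longrightarrow> orthonormal_basis_of ?T B \<Longrightarrow> (\<Sum>b\<in>B. G \<bullet> \<beta> b b) = - (G \<bullet> p) / 2"
    by blast
  have var: "p \<bullet> v = 0 \<and> 0 \<le> v \<bullet> v + p \<bullet> \<beta> v v" if v: "v \<in> ?T" for v
  proof -
    from curve[OF v, unfolded two_jet_def] obtain \<gamma> \<gamma>' \<epsilon> where \<epsilon>: "\<epsilon> > 0" and \<gamma>: "\<gamma> 0 = p" "\<gamma>' 0 = v"
      "\<And>t. \<bar>t\<bar> < \<epsilon> \<Longrightarrow> \<gamma> t \<in> \<Sigma>"
      and d1: "\<And>t. \<bar>t\<bar> < \<epsilon> \<Longrightarrow> (\<gamma> has_vector_derivative \<gamma>' t) (at t)"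
      and d2: "(\<gamma>' has_vector_derivative \<beta> v v) (at 0)" by metis
    have 1: "DERIV (\<lambda>t. \<gamma> t \<bullet> \<gamma> t) t :> 2 * (\<gamma> t \<bullet> \<gamma>' t)" if "\<bar>t\<bar> < \<epsilon>" for t
      using has_derivative_inner[OF d1[OF that, unfolded has_vector_derivative_def]
          d1[OF that, unfolded has_vector_derivative_def]]
      by (rule has_derivative_imp_has_field_derivative) (simp add: inner_commute)
    have 2: "DERIV (\<lambda>t. 2 * (\<gamma> t \<bullet> \<gamma>' t)) 0 :> 2 * (v \<bullet> v + p \<bullet> \<beta> v v)"
      using has_derivative_inner[OF d1[of 0, unfolded has_vector_derivative_def]
          d2[unfolded has_vector_derivative_def]] \<epsilon> \<gamma>(1,2)
      by (intro DERIV_cmult has_derivative_imp_has_field_derivative) (auto simp: algebra_simps)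
    have "\<gamma> 0 \<bullet> \<gamma> 0 \<le> \<gamma> t \<bullet> \<gamma> t" if "\<bar>t\<bar> < \<epsilon>" for t
      using min[OF \<gamma>(3)[OF that]] \<gamma>(1) by (simp add: norm_le)
    from local_min_second_derivative[OF \<epsilon> 1 2 this] \<gamma> show ?thesis by simp
  qed
  obtain B where B: "orthonormal_basis_of ?T B"
    using orthonormal_basis_subspace[OF T(1)] unfolding orthonormal_basis_of_def by metis
  note b = orthonormal_basis_of_properties[OF B]
  have "p \<in> ?T\<^sup>\<bottom>" using var by (auto simp: orthogonal_comp_def orthogonal_def inner_commute)
  then have "(\<Sum>b\<in>B. p \<bullet> \<beta> b b) = - (p \<bullet> p) / 2" using trace B by blast
  moreover have "(\<Sum>b\<in>B. b \<bullet> b) = d" using b(2,5) T(2) by simp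
  moreover have "0 \<le> (\<Sum>b\<in>B. b \<bullet> b + p \<bullet> \<beta> b b)"
    using var b(3) by (intro sum_nonneg) blast
  ultimately have "p \<bullet> p \<le> 2 * d" by (simp add: sum.distrib)
  with p show ?thesis by (rule that)
qed

section \<open>Unit normals of hyperplanes and the reflection matching two of them\<close>

lemma hyperplane_unit_normal:
  fixes T :: "'a::euclidean_space set"
  assumes "subspace T" "DIM('a) = dim T + 1"
  obtains \<nu> where "norm \<nu> = 1" "T = {x. \<nu> \<bullet> x = 0}"
proof -
  obtain a where a: "a \<noteq> 0" "T \<subseteq> {x. a \<bullet> x = 0}"
    using lowdim_subset_hyperplane[of T] assms by (metis less_add_one span_eq_iff)
  have "T = {x. a \<bullet> x = 0}"
    using a assms dim_hyperplane[OF a(1)] by (intro subspace_dim_equal) (auto simp: subspace_hyperplane)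
  then show ?thesis using a(1) by (intro that[of "sgn a"]) (auto simp: sgn_div_norm)
qed

lemma unit_normal_unique:
  fixes T :: "'a::euclidean_space set"
  assumes "subspace T" "DIM('a) = dim T + 1" "norm w = 1" "\<And>x. x \<in> T \<Longrightarrow> w \<bullet> x = 0"
  shows "T = {x. w \<bullet> x = 0}"
proof (rule subspace_dim_equal)
  show "dim {x. w \<bullet> x = 0} \<le> dim T" using dim_hyperplane[of w] assms by fastforce
qed (use assms subspace_hyperplane in auto)

text \<open>The left side is the squared length of the tangential part of \<open>x\<close>; subtract
  the component along \<open>\<nu>\<close> and apply Parseval in the hyperplane.\<close>

lemma parseval_hyperplane:
  fixes B :: "'a::euclidean_space set"
  assumes B: "orthonormal_basis_of {x. \<nu> \<bullet> x = 0} B" and \<nu>: "norm \<nu> = 1"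
  shows "(\<Sum>b\<in>B. (x \<bullet> b)\<^sup>2) = x \<bullet> x - (x \<bullet> \<nu>)\<^sup>2"
proof -
  let ?y = "x - (x \<bullet> \<nu>) *\<^sub>R \<nu>"
  have [simp]: "\<nu> \<bullet> \<nu> = 1" using \<nu> by (simp add: dot_square_norm)
  have y: "?y \<in> {x. \<nu> \<bullet> x = 0}" by (simp add: inner_diff_right inner_commute)
  have "(\<Sum>b\<in>B. (x \<bullet> b)\<^sup>2) = (\<Sum>b\<in>B. (?y \<bullet> b) * (x \<bullet> b))"
    using orthonormal_basis_of_properties(3)[OF B]
    by (intro sum.cong) (auto simp: inner_diff_left power2_eq_square)
  also have "\<dots> = ?y \<bullet> x" by (rule parseval_orthonormal_basis_of[OF B y])
  finally show ?thesis by (simp add: inner_diff_left inner_commute[of \<nu> x] power2_eq_square)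
qed

text \<open>Since |\<nu> + w|^2 = 2 (1 + \<nu> \<bullet> w), \<open>S\<close> is the reflection in
  the hyperplane orthogonal to \<open>\<nu> + w\<close>. It sends \<nu> to -w, hence one hyperplane
  to the other, and fixes their intersection pointwise. The sign condition keeps the denominator
  positive. Each \<open>b - S b\<close> is a multiple of \<open>\<nu> + w\<close>, so Parseval
  evaluates the mismatch.\<close>

lemma reflection_orthonormal_basis_of:
  fixes B :: "'a::euclidean_space set"
  assumes B: "orthonormal_basis_of {x. \<nu> \<bullet> x = 0} B" and \<nu>: "norm \<nu> = 1" and w: "norm w = 1"
    and c: "0 \<le> \<nu> \<bullet> w"
  defines "S \<equiv> \<lambda>x. x - ((x \<bullet> (\<nu> + w)) / (1 + \<nu> \<bullet> w)) *\<^sub>R (\<nu> + w)"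
  shows "orthonormal_basis_of {x. w \<bullet> x = 0} (S ` B)" "inj_on S B"
    and "(\<Sum>b\<in>B. (b - S b) \<bullet> (b - S b)) = 2 * (1 - \<nu> \<bullet> w)"
proof -
  define s where "s = \<nu> + w"
  define k where "k = 1 + \<nu> \<bullet> w"
  have pos: "k > 0" using c by (simp add: k_def)
  have S: "S x = x - ((x \<bullet> s) / k) *\<^sub>R s" for x by (simp add: S_def s_def k_def)
  have \<nu>\<nu>: "\<nu> \<bullet> \<nu> = 1" and ww: "w \<bullet> w = 1" using \<nu> w by (simp_all add: dot_square_norm)
  have s\<nu>: "s \<bullet> \<nu> = k" and sw: "s \<bullet> w = k"
    using \<nu>\<nu> ww by (simp_all add: s_def k_def inner_add_left inner_commute[of w \<nu>])
  have ss: "s \<bullet> s = 2 * k" using s\<nu> sw by (simp add: s_def inner_add_right)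
  have xs: "x \<bullet> s = x \<bullet> \<nu> + x \<bullet> w" for x by (simp add: s_def inner_add_right)
  have expand: "(x - a *\<^sub>R s) \<bullet> (y - b *\<^sub>R s) = x \<bullet> y - b * (x \<bullet> s) - a * (y \<bullet> s) + a * b * (s \<bullet> s)"
    for x y a b
    by (simp add: inner_diff_left inner_diff_right algebra_simps inner_commute[of s x] inner_commute[of s y])
  have lin: "linear S" unfolding S
    by (intro linearI) (simp_all add: inner_add_left add_divide_distrib algebra_simps)
  have S_inner: "S x \<bullet> S y = x \<bullet> y" for x y
    unfolding S expand ss using pos by (simp add: field_simps)
  have S_w: "S x \<bullet> w = - (x \<bullet> \<nu>)" and S_\<nu>: "S x \<bullet> \<nu> = - (x \<bullet> w)" for x
    using pos by (simp_all add: S inner_diff_left sw s\<nu> xs)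
  have SS: "S (S x) = x" for x
    using pos by (simp add: S inner_diff_left ss)
  then have inj: "inj S" by (metis injI)
  then show "inj_on S B" by (rule inj_on_subset) simp
  have "S ` {x. \<nu> \<bullet> x = 0} = {x. w \<bullet> x = 0}"
  proof safe
    fix x assume "w \<bullet> x = 0"
    then have "\<nu> \<bullet> S x = 0" using S_\<nu>[of x] by (simp add: inner_commute)
    then show "x \<in> S ` {x. \<nu> \<bullet> x = 0}" using SS[of x] by (metis (mono_tags) image_eqI mem_Collect_eq)
  next
    fix x assume "\<nu> \<bullet> x = 0"
    then show "w \<bullet> S x = 0" using S_w[of x] by (simp add: inner_commute)
  qed
  then have "span (S ` B) = {x. w \<bullet> x = 0}"
    using B linear_span_image[OF lin] unfolding orthonormal_basis_of_def by metis
  moreover have "norm (S b) = norm b" for b by (simp add: norm_eq_sqrt_inner S_inner)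
  ultimately show "orthonormal_basis_of {x. w \<bullet> x = 0} (S ` B)"
    using B unfolding orthonormal_basis_of_def pairwise_def orthogonal_def by (auto simp: S_inner)
  have "(b - S b) \<bullet> (b - S b) = (2 / k) * (w \<bullet> b)\<^sup>2" if "b \<in> B" for b
  proof -
    have "\<nu> \<bullet> b = 0" using orthonormal_basis_of_properties(3)[OF B] that by auto
    then have "b \<bullet> s = w \<bullet> b" by (simp add: xs inner_commute)
    then have "(b - S b) \<bullet> (b - S b) = ((w \<bullet> b) / k)\<^sup>2 * (s \<bullet> s)"
      by (simp add: S power2_eq_square)
    then show ?thesis
      unfolding ss using pos by (simp add: field_simps power2_eq_square)
  qed
  then have "(\<Sum>b\<in>B. (b - S b) \<bullet> (b - S b)) = (2 / k) * (\<Sum>b\<in>B. (w \<bullet> b)\<^sup>2)"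
    by (simp add: sum_distrib_left)
  also have "\<dots> = (2 / k) * (1 - (\<nu> \<bullet> w)\<^sup>2)"
    unfolding parseval_hyperplane[OF B \<nu>] ww by (simp add: inner_commute)
  also have "1 - (\<nu> \<bullet> w)\<^sup>2 = k * (1 - \<nu> \<bullet> w)" by (simp add: k_def power2_eq_square algebra_simps)
  finally show "(\<Sum>b\<in>B. (b - S b) \<bullet> (b - S b)) = 2 * (1 - \<nu> \<bullet> w)" using pos by simp
qed

section \<open>The two-point function along a pair of curves\<close>

lemma DERIV_inner_curves:
  assumes "(f has_vector_derivative f') (at t)" "(g has_vector_derivative g') (at t)"
  shows "DERIV (\<lambda>t. f t \<bullet> g t) t :> f t \<bullet> g' + f' \<bullet> g t"
  using has_derivative_inner[OF assms[unfolded has_vector_derivative_def]]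
  by (rule has_derivative_imp_has_field_derivative) (simp add: algebra_simps)

text \<open>The second derivative test for |\<gamma> - \<eta>|^2 - \<mu> (\<rho>^2 -
  |\<gamma>|^2)^4, which vanishes at \<open>0\<close> and is nonnegative nearby. \<open>G\<close> is
  the gradient in the first point, -2 (p - q) the one in the second.\<close>

lemma two_point_variation:
  fixes \<Sigma>\<^sub>1 \<Sigma>\<^sub>2 :: "'a::euclidean_space set" and \<gamma> \<eta> :: "real \<Rightarrow> 'a"
  assumes \<epsilon>: "\<epsilon> > 0" and p: "\<gamma> 0 = p" "norm p < \<rho>" and q: "\<eta> 0 = q"
    and v: "\<gamma>' 0 = v" "\<eta>' 0 = w"
    and in_\<Sigma>: "\<And>t. \<bar>t\<bar> < \<epsilon> \<Longrightarrow> \<gamma> t \<in> \<Sigma>\<^sub>1" "\<And>t. \<bar>t\<bar> < \<epsilon> \<Longrightarrow> \<eta> t \<in> \<Sigma>\<^sub>2"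
    and d1: "\<And>t. \<bar>t\<bar> < \<epsilon> \<Longrightarrow> (\<gamma> has_vector_derivative \<gamma>' t) (at t)"
      "\<And>t. \<bar>t\<bar> < \<epsilon> \<Longrightarrow> (\<eta> has_vector_derivative \<eta>' t) (at t)"
    and d2: "(\<gamma>' has_vector_derivative a) (at 0)" "(\<eta>' has_vector_derivative b) (at 0)"
    and eq: "(p - q) \<bullet> (p - q) = \<mu> * (\<rho>\<^sup>2 - p \<bullet> p) ^ 4"
    and min: "\<And>x y. x \<in> \<Sigma>\<^sub>1 \<Longrightarrow> y \<in> \<Sigma>\<^sub>2 \<Longrightarrow> norm x \<le> \<rho> \<Longrightarrow> \<mu> * (\<rho>\<^sup>2 - x \<bullet> x) ^ 4 \<le> (x - y) \<bullet> (x - y)"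
  defines "\<phi> \<equiv> \<rho>\<^sup>2 - p \<bullet> p"
  defines "G \<equiv> 2 *\<^sub>R (p - q) + (8 * \<mu> * \<phi> ^ 3) *\<^sub>R p"
  shows "G \<bullet> v - 2 * ((p - q) \<bullet> w) = 0"
    and "0 \<le> 2 * ((v - w) \<bullet> (v - w)) + G \<bullet> a - 2 * ((p - q) \<bullet> b) - 48 * \<mu> * \<phi>\<^sup>2 * (p \<bullet> v)\<^sup>2 + 8 * \<mu> * \<phi> ^ 3 * (v \<bullet> v)"
proof -
  define f where "f t = (\<gamma> t - \<eta> t) \<bullet> (\<gamma> t - \<eta> t) - \<mu> * (\<rho>\<^sup>2 - \<gamma> t \<bullet> \<gamma> t) ^ 4" for t
  define f' where "f' t = 2 * ((\<gamma> t - \<eta> t) \<bullet> (\<gamma>' t - \<eta>' t)) + 8 * \<mu> * ((\<rho>\<^sup>2 - \<gamma> t \<bullet> \<gamma> t) ^ 3 * (\<gamma> t \<bullet> \<gamma>' t))" for t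
  \<comment> \<open>\<open>min\<close> speaks only of points of norm at most \<open>\<rho>\<close>;
    the strict bound at \<open>p\<close> keeps \<open>\<gamma>\<close> there for small
    \<open>t\<close>.\<close>
  have "isCont \<gamma> 0" using d1(1)[of 0] \<epsilon> by (auto dest: has_vector_derivative_continuous)
  then have "\<forall>\<^sub>F t in at 0. norm (\<gamma> t) < \<rho>"
    using p order_tendstoD(2)[OF tendsto_norm] unfolding isCont_def by blast
  then obtain d where d: "d > 0" "\<And>t. t \<noteq> 0 \<Longrightarrow> \<bar>t\<bar> < d \<Longrightarrow> norm (\<gamma> t) < \<rho>"
    unfolding eventually_at by (auto simp: dist_norm)
  have "f 0 \<le> f t" if t: "\<bar>t\<bar> < min \<epsilon> d" for t
  proof -
    have "norm (\<gamma> t) \<le> \<rho>" using d(2)[of t] t p by (cases "t = 0") auto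
    then have "0 \<le> f t" using min[of "\<gamma> t" "\<eta> t"] in_\<Sigma>[of t] t by (simp add: f_def)
    then show ?thesis using eq p q by (simp add: f_def)
  qed
  moreover have "DERIV f t :> f' t" if "\<bar>t\<bar> < min \<epsilon> d" for t
  proof -
    have t: "\<bar>t\<bar> < \<epsilon>" using that by simp
    note \<delta> = has_vector_derivative_diff[OF d1(1)[OF t] d1(2)[OF t]]
    note g = d1(1)[OF t]
    show ?thesis unfolding f_def[abs_def] f'_def
      by (rule derivative_eq_intros DERIV_inner_curves[OF \<delta> \<delta>] DERIV_inner_curves[OF g g] refl)+
        (simp add: inner_commute[of "\<gamma>' t"] inner_commute[of "\<eta>' t"] algebra_simps)
  qed
  moreover have "DERIV f' 0 :> 2 * ((p - q) \<bullet> (a - b) + (v - w) \<bullet> (v - w)) +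
      8 * \<mu> * (\<phi> ^ 3 * (p \<bullet> a + v \<bullet> v) - 6 * \<phi>\<^sup>2 * (p \<bullet> v)\<^sup>2)"
  proof -
    have g: "(\<gamma> has_vector_derivative v) (at 0)" and h: "(\<eta> has_vector_derivative w) (at 0)"
      using d1[of 0] \<epsilon> v by simp_all
    note \<delta> = has_vector_derivative_diff[OF g h] and \<delta>' = has_vector_derivative_diff[OF d2]
    show ?thesis unfolding f'_def[abs_def] \<phi>_def
      by (rule derivative_eq_intros DERIV_inner_curves[OF \<delta> \<delta>'] DERIV_inner_curves[OF g g]
          DERIV_inner_curves[OF g d2(1)] refl)+
        (simp add: p q v inner_commute[of v p] power2_eq_square algebra_simps)
  qed
  moreover have "min \<epsilon> d > 0" using \<epsilon> d by simp
  ultimately have "f' 0 = 0" and "0 \<le> 2 * ((p - q) \<bullet> (a - b) + (v - w) \<bullet> (v - w)) +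
      8 * \<mu> * (\<phi> ^ 3 * (p \<bullet> a + v \<bullet> v) - 6 * \<phi>\<^sup>2 * (p \<bullet> v)\<^sup>2)"
    using local_min_second_derivative by blast+
  then show "G \<bullet> v - 2 * ((p - q) \<bullet> w) = 0"
    and "0 \<le> 2 * ((v - w) \<bullet> (v - w)) + G \<bullet> a - 2 * ((p - q) \<bullet> b) - 48 * \<mu> * \<phi>\<^sup>2 * (p \<bullet> v)\<^sup>2 + 8 * \<mu> * \<phi> ^ 3 * (v \<bullet> v)"
    by (simp_all add: f'_def G_def p q v \<phi>_def[symmetric] inner_diff_right inner_add_left algebra_simps)
qed

text \<open>Read contrapositively: when \<open>\<rho>\<close> is large, no minimising pair of
  interior points exists. The smallness of \<open>\<mu>\<close> limits the tilt between the two
  tangent planes.\<close>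

lemma two_point_bound:
  fixes \<Sigma>\<^sub>1 \<Sigma>\<^sub>2 :: "'a::euclidean_space set"
  assumes dim: "DIM('a) = n + 1" and "shrinker n \<Sigma>\<^sub>1" "shrinker n \<Sigma>\<^sub>2"
    and int: "p \<in> manifold_interior n \<Sigma>\<^sub>1" "q \<in> manifold_interior n \<Sigma>\<^sub>2"
    and p: "norm p < \<rho>" and \<mu>: "\<mu> > 0" "18 * \<mu> * \<rho> ^ 6 \<le> 1"
    and eq: "(p - q) \<bullet> (p - q) = \<mu> * (\<rho>\<^sup>2 - p \<bullet> p) ^ 4"
    and min: "\<And>x y. x \<in> \<Sigma>\<^sub>1 \<Longrightarrow> y \<in> \<Sigma>\<^sub>2 \<Longrightarrow> norm x \<le> \<rho> \<Longrightarrow> \<mu> * (\<rho>\<^sup>2 - x \<bullet> x) ^ 4 \<le> (x - y) \<bullet> (x - y)"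
  shows "\<rho>\<^sup>2 \<le> 8 * n"
proof -
  let ?T\<^sub>1 = "tangent_space \<Sigma>\<^sub>1 p" and ?T\<^sub>2 = "tangent_space \<Sigma>\<^sub>2 q"
  from shrinker_interior_expansion[OF assms(2) int(1)] obtain \<beta>\<^sub>1 where T\<^sub>1: "subspace ?T\<^sub>1" "dim ?T\<^sub>1 = n"
    and curve1: "\<And>v. v \<in> ?T\<^sub>1 \<Longrightarrow> two_jet \<Sigma>\<^sub>1 p v (\<beta>\<^sub>1 v v)"
    and trace1: "\<And>G B. G \<in> ?T\<^sub>1\<^sup>\<bottom> \<Longrightarrow> orthonormal_basis_of ?T\<^sub>1 B \<Longrightarrow> (\<Sum>b\<in>B. G \<bullet> \<beta>\<^sub>1 b b) = - (G \<bullet> p) / 2"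
    by blast
  from shrinker_interior_expansion[OF assms(3) int(2)] obtain \<beta>\<^sub>2 where T\<^sub>2: "subspace ?T\<^sub>2" "dim ?T\<^sub>2 = n"
    and curve2: "\<And>v. v \<in> ?T\<^sub>2 \<Longrightarrow> two_jet \<Sigma>\<^sub>2 q v (\<beta>\<^sub>2 v v)"
    and trace2: "\<And>G B. G \<in> ?T\<^sub>2\<^sup>\<bottom> \<Longrightarrow> orthonormal_basis_of ?T\<^sub>2 B \<Longrightarrow> (\<Sum>b\<in>B. G \<bullet> \<beta>\<^sub>2 b b) = - (G \<bullet> q) / 2"
    by blast
  define \<phi> where "\<phi> = \<rho>\<^sup>2 - p \<bullet> p"
  define G where "G = 2 *\<^sub>R (p - q) + (8 * \<mu> * \<phi> ^ 3) *\<^sub>R p"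
  have \<rho>: "\<rho> > 0" using p by (meson norm_ge_zero order_le_less_trans)
  have pp: "p \<bullet> p < \<rho>\<^sup>2" using p by (simp add: dot_square_norm power_strict_mono)
  then have \<phi>: "\<phi> > 0" "\<phi> \<le> \<rho>\<^sup>2" by (simp_all add: \<phi>_def)
  \<comment> \<open>\<open>v\<close> and \<open>w\<close> are independent: any tangent vector at
    \<open>p\<close> may be paired with any at \<open>q\<close>.\<close>
  have var: "G \<bullet> v - 2 * ((p - q) \<bullet> w) = 0 \<and>
    0 \<le> 2 * ((v - w) \<bullet> (v - w)) + G \<bullet> \<beta>\<^sub>1 v v - 2 * ((p - q) \<bullet> \<beta>\<^sub>2 w w) - 48 * \<mu> * \<phi>\<^sup>2 * (p \<bullet> v)\<^sup>2 + 8 * \<mu> * \<phi> ^ 3 * (v \<bullet> v)"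
    if v: "v \<in> ?T\<^sub>1" and w: "w \<in> ?T\<^sub>2" for v w
  proof -
    from curve1[OF v, unfolded two_jet_def] obtain \<gamma> \<gamma>' \<epsilon> where \<epsilon>: "\<epsilon> > 0" and \<gamma>: "\<gamma> 0 = p" "\<gamma>' 0 = v"
      "\<And>t. \<bar>t\<bar> < \<epsilon> \<Longrightarrow> \<gamma> t \<in> \<Sigma>\<^sub>1" "\<And>t. \<bar>t\<bar> < \<epsilon> \<Longrightarrow> (\<gamma> has_vector_derivative \<gamma>' t) (at t)"
      and \<gamma>': "(\<gamma>' has_vector_derivative \<beta>\<^sub>1 v v) (at 0)" by metis
    from curve2[OF w, unfolded two_jet_def] obtain \<eta> \<eta>' \<epsilon>' where \<epsilon>': "\<epsilon>' > 0" and \<eta>: "\<eta> 0 = q" "\<eta>' 0 = w"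
      "\<And>t. \<bar>t\<bar> < \<epsilon>' \<Longrightarrow> \<eta> t \<in> \<Sigma>\<^sub>2" "\<And>t. \<bar>t\<bar> < \<epsilon>' \<Longrightarrow> (\<eta> has_vector_derivative \<eta>' t) (at t)"
      and \<eta>': "(\<eta>' has_vector_derivative \<beta>\<^sub>2 w w) (at 0)" by metis
    have "min \<epsilon> \<epsilon>' > 0" using \<epsilon> \<epsilon>' by simp
    note V = two_point_variation[where \<gamma> = \<gamma> and \<gamma>' = \<gamma>' and \<eta> = \<eta> and \<eta>' = \<eta>', OF this \<gamma>(1) p \<eta>(1) \<gamma>(2) \<eta>(2) _ _ _ _ \<gamma>' \<eta>' eq min]
    show ?thesis unfolding G_def \<phi>_def
      by (rule conjI; rule V) (use \<gamma> \<eta> in auto)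
  qed
  \<comment> \<open>Setting \<open>w = 0\<close> makes \<open>G\<close> normal at \<open>p\<close>;
    setting \<open>v = 0\<close> makes \<open>p - q\<close> normal at \<open>q\<close>.\<close>
  have G: "G \<in> ?T\<^sub>1\<^sup>\<bottom>" and pq: "p - q \<in> ?T\<^sub>2\<^sup>\<bottom>"
    using var[OF _ subspace_0[OF T\<^sub>2(1)]] var[OF subspace_0[OF T\<^sub>1(1)]]
    by (auto simp: orthogonal_comp_def orthogonal_def inner_commute)
  define r where "r = norm (p - q)"
  have r2: "r\<^sup>2 = \<mu> * \<phi> ^ 4" using eq by (simp add: r_def \<phi>_def dot_square_norm)
  moreover have "r \<ge> 0" by (simp add: r_def)
  ultimately have r: "r > 0" using \<mu>(1) \<phi>(1) by (cases "r = 0") auto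
  define w where "w = (1 / r) *\<^sub>R (p - q)"
  have w: "norm w = 1" "p - q = r *\<^sub>R w" using r by (auto simp: w_def r_def)
  have T2: "?T\<^sub>2 = {x. w \<bullet> x = 0}"
  proof (rule unit_normal_unique[OF T\<^sub>2(1)])
    show "w \<bullet> x = 0" if "x \<in> ?T\<^sub>2" for x
      using pq that by (auto simp: w_def orthogonal_comp_def orthogonal_def inner_commute)
  qed (use w dim T\<^sub>2 in auto)
  obtain \<nu>' where \<nu>': "norm \<nu>' = 1" "?T\<^sub>1 = {x. \<nu>' \<bullet> x = 0}"
    using hyperplane_unit_normal[OF T\<^sub>1(1)] dim T\<^sub>1(2) by metis
  \<comment> \<open>The normal at \<open>p\<close> is determined up to sign; the sign with
    nonnegative cosine makes the reflection available.\<close>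
  define \<nu> where "\<nu> = (if 0 \<le> \<nu>' \<bullet> w then \<nu>' else - \<nu>')"
  have \<nu>: "norm \<nu> = 1" "?T\<^sub>1 = {x. \<nu> \<bullet> x = 0}" and c0: "0 \<le> \<nu> \<bullet> w"
    using \<nu>' by (auto simp: \<nu>_def)
  have \<nu>\<nu>: "\<nu> \<bullet> \<nu> = 1" and ww: "w \<bullet> w = 1" using \<nu>(1) w(1) by (simp_all add: dot_square_norm)
  define c where "c = \<nu> \<bullet> w"
  define P where "P = p \<bullet> p - (p \<bullet> \<nu>)\<^sup>2"
  \<comment> \<open>Half of \<open>G\<close> is r w + 4 \<mu> \<phi>^3 p and has no tangential part,
    so the tangential parts of r w and -4 \<mu> \<phi>^3 p agree. Their squared lengths give r^2 (1
    - c^2) = 16 \<mu>^2 \<phi>^6 P, to be divided by r^2 = \<mu> \<phi>^4. Facts \<open>1\<close>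
    and \<open>2\<close> test with the tangential parts of \<open>w\<close> and
    \<open>p\<close>.\<close>
  have c_eq: "1 - c\<^sup>2 = 16 * \<mu> * \<phi>\<^sup>2 * P"
  proof -
    have tang: "x - (x \<bullet> \<nu>) *\<^sub>R \<nu> \<in> ?T\<^sub>1" for x
      unfolding \<nu>(2) using \<nu>\<nu> by (simp add: inner_diff_right inner_commute)
    have *: "(r *\<^sub>R w + (4 * \<mu> * \<phi> ^ 3) *\<^sub>R p) \<bullet> (x - (x \<bullet> \<nu>) *\<^sub>R \<nu>) = 0" for x
    proof -
      have "G \<bullet> (x - (x \<bullet> \<nu>) *\<^sub>R \<nu>) = 0"
        using G tang[of x] by (auto simp: orthogonal_comp_def orthogonal_def inner_commute)
      moreover have "G = 2 *\<^sub>R (r *\<^sub>R w + (4 * \<mu> * \<phi> ^ 3) *\<^sub>R p)" by (simp add: G_def w(2) scaleR_add_right)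
      ultimately show ?thesis by simp
    qed
    have 1: "r * (1 - c\<^sup>2) = - (4 * \<mu> * \<phi> ^ 3) * (p \<bullet> w - c * (p \<bullet> \<nu>))"
      using *[of w] ww by (simp add: c_def inner_add_left inner_diff_right inner_commute[of w \<nu>] power2_eq_square algebra_simps)
    have 2: "r * (p \<bullet> w - c * (p \<bullet> \<nu>)) = - (4 * \<mu> * \<phi> ^ 3) * P"
      using *[of p] by (simp add: P_def c_def inner_add_left inner_diff_right inner_commute[of w p] inner_commute[of w \<nu>] power2_eq_square algebra_simps)
    have "(\<mu> * \<phi> ^ 4) * (1 - c\<^sup>2) = r * (r * (1 - c\<^sup>2))"
      unfolding r2[symmetric] by (simp add: power2_eq_square)
    also have "\<dots> = - (4 * \<mu> * \<phi> ^ 3) * (r * (p \<bullet> w - c * (p \<bullet> \<nu>)))" unfolding 1 by simp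
    also have "\<dots> = (\<mu> * \<phi> ^ 4) * (16 * \<mu> * \<phi>\<^sup>2 * P)"
      unfolding 2 by (simp add: eval_nat_numeral)
    finally have "(\<mu> * \<phi> ^ 4) * (1 - c\<^sup>2) = (\<mu> * \<phi> ^ 4) * (16 * \<mu> * \<phi>\<^sup>2 * P)" .
    then show ?thesis using \<mu>(1) \<phi>(1) by simp
  qed
  have "P \<le> \<rho>\<^sup>2" using pp by (simp add: P_def) (smt (verit) zero_le_power2)
  \<comment> \<open>The factor 18 in the hypothesis is made for this: 1 - c^2 \<le> 16 \<mu>
    \<rho>^6 \<le> 16/18 = 8/9.\<close>
  have "c \<ge> 1/3"
  proof -
    have "\<phi>\<^sup>2 * P \<le> \<phi>\<^sup>2 * \<rho>\<^sup>2" using \<open>P \<le> \<rho>\<^sup>2\<close> by (intro mult_left_mono) auto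
    also have "\<dots> \<le> (\<rho>\<^sup>2)\<^sup>2 * \<rho>\<^sup>2" using \<phi> by (intro mult_right_mono power_mono) auto
    also have "\<dots> = \<rho> ^ 6" by (simp add: power_mult[symmetric] power_add[symmetric])
    finally have "\<mu> * (\<phi>\<^sup>2 * P) \<le> \<mu> * \<rho> ^ 6" using \<mu>(1) by (intro mult_left_mono) auto
    moreover have "1 - c\<^sup>2 = 16 * (\<mu> * (\<phi>\<^sup>2 * P))" using c_eq by simp
    moreover have "18 * (\<mu> * \<rho> ^ 6) \<le> 1" using \<mu>(2) by simp
    ultimately have "1 - c\<^sup>2 \<le> 8/9" by linarith
    then have "(1/3)\<^sup>2 \<le> c\<^sup>2" by (simp add: power2_eq_square)
    then show ?thesis using c0 unfolding c_def by (rule power2_le_imp_le)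
  qed
  obtain B where B: "orthonormal_basis_of ?T\<^sub>1 B"
    using orthonormal_basis_subspace[OF T\<^sub>1(1)] unfolding orthonormal_basis_of_def by metis
  define S where "S x = x - ((x \<bullet> (\<nu> + w)) / (1 + \<nu> \<bullet> w)) *\<^sub>R (\<nu> + w)" for x
  note b = orthonormal_basis_of_properties[OF B]
  note refl = reflection_orthonormal_basis_of[OF B[unfolded \<nu>(2)] \<nu>(1) w(1) c0, folded S_def]
  have S: "orthonormal_basis_of ?T\<^sub>2 (S ` B)" using refl(1) T2 by simp
  \<comment> \<open>Second variation with \<open>v = b\<close> and \<open>w = S b\<close>. Since the
    reflected basis is orthonormal at \<open>q\<close>, both curvature sums are traces.\<close>
  have "0 \<le> (\<Sum>b\<in>B. 2 * ((b - S b) \<bullet> (b - S b)) + G \<bullet> \<beta>\<^sub>1 b b - 2 * ((p - q) \<bullet> \<beta>\<^sub>2 (S b) (S b))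
      - 48 * \<mu> * \<phi>\<^sup>2 * (p \<bullet> b)\<^sup>2 + 8 * \<mu> * \<phi> ^ 3 * (b \<bullet> b))"
    using var b(3) orthonormal_basis_of_properties(3)[OF S] by (intro sum_nonneg) blast
  also have "\<dots> = 2 * (\<Sum>b\<in>B. (b - S b) \<bullet> (b - S b)) + (\<Sum>b\<in>B. G \<bullet> \<beta>\<^sub>1 b b)
      - 2 * (\<Sum>b\<in>B. (p - q) \<bullet> \<beta>\<^sub>2 (S b) (S b)) - 48 * \<mu> * \<phi>\<^sup>2 * (\<Sum>b\<in>B. (p \<bullet> b)\<^sup>2)
      + 8 * \<mu> * \<phi> ^ 3 * (\<Sum>b\<in>B. b \<bullet> b)"
    by (simp add: sum.distrib sum_subtractf sum_distrib_left)
  also have "(\<Sum>b\<in>B. (p - q) \<bullet> \<beta>\<^sub>2 (S b) (S b)) = (\<Sum>b\<in>S ` B. (p - q) \<bullet> \<beta>\<^sub>2 b b)"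
    using refl(2) by (simp add: sum.reindex)
  also have "\<dots> = - ((p - q) \<bullet> q) / 2" by (rule trace2[OF pq S])
  also have "(\<Sum>b\<in>B. G \<bullet> \<beta>\<^sub>1 b b) = - (G \<bullet> p) / 2" by (rule trace1[OF G B])
  also have "(\<Sum>b\<in>B. b \<bullet> b) = n" using b(2,5) T\<^sub>1(2) by simp
  also have "(\<Sum>b\<in>B. (p \<bullet> b)\<^sup>2) = P"
    unfolding P_def by (rule parseval_hyperplane[OF B[unfolded \<nu>(2)] \<nu>(1)])
  also have "(\<Sum>b\<in>B. (b - S b) \<bullet> (b - S b)) = 2 * (1 - c)"
    unfolding c_def by (rule refl(3))
  finally have "0 \<le> 4 * (1 - c) - G \<bullet> p / 2 + (p - q) \<bullet> q - 48 * \<mu> * \<phi>\<^sup>2 * P + 8 * \<mu> * \<phi> ^ 3 * n"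
    by simp
  moreover have "- G \<bullet> p / 2 + (p - q) \<bullet> q = - (\<mu> * \<phi> ^ 4) - 4 * \<mu> * \<phi> ^ 3 * (p \<bullet> p)"
    using eq unfolding \<phi>_def[symmetric]
    by (simp add: G_def inner_add_left inner_diff_left inner_diff_right inner_commute[of q p] field_simps)
  \<comment> \<open>By \<open>c_eq\<close> the subtracted term is 3 (1 - c) (1 + c); the threshold
    1/3 is the root of the remaining factor.\<close>
  moreover have "4 * (1 - c) - 48 * \<mu> * \<phi>\<^sup>2 * P = (1 - c) * (1 - 3 * c)"
    using c_eq by (simp add: algebra_simps power2_eq_square)
  moreover have "(1 - c) * (1 - 3 * c) \<le> 0"
  proof (rule mult_nonneg_nonpos)
    show "0 \<le> 1 - c" using norm_cauchy_schwarz[of \<nu> w] \<nu>(1) w(1) by (simp add: c_def)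
  qed (use \<open>c \<ge> 1/3\<close> in simp)
  ultimately have "0 \<le> (\<mu> * \<phi> ^ 3) * (8 * n - \<phi> - 4 * (p \<bullet> p))"
    by (simp add: algebra_simps power4_eq_xxxx power3_eq_cube)
  then have "0 \<le> 8 * n - \<phi> - 4 * (p \<bullet> p)"
    using mult_pos_pos[OF \<mu>(1) zero_less_power[OF \<phi>(1), of 3]] by (simp only: zero_le_mult_iff) linarith
  \<comment> \<open>Now \<phi> + 4 |p|^2 \<le> 8 n, while \<rho>^2 = \<phi> + |p|^2.\<close>
  then show ?thesis using inner_ge_zero[of p] unfolding \<phi>_def by linarith
qed

subsection \<open>Intersection\<close>

text \<open>The quotient |x - y|^2 / \<phi>(x)^4 degenerates on the sphere of radius
  \<open>\<rho>\<close>, so it is minimised over its sublevel set through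
  \<open>(p\<^sub>0, q\<^sub>0)\<close>. Written without division this set is compact, and
  disjointness keeps it off the sphere. The last conclusion serves to bound \<open>\<mu>\<close>
  from above.\<close>

lemma two_point_minimum:
  fixes \<Sigma>\<^sub>1 \<Sigma>\<^sub>2 :: "'a::euclidean_space set"
  assumes compact: "compact \<Sigma>\<^sub>1" "compact \<Sigma>\<^sub>2" and disj: "cball 0 \<rho> \<inter> \<Sigma>\<^sub>1 \<inter> \<Sigma>\<^sub>2 = {}"
    and p\<^sub>0: "p\<^sub>0 \<in> \<Sigma>\<^sub>1" "norm p\<^sub>0 < \<rho>" and q\<^sub>0: "q\<^sub>0 \<in> \<Sigma>\<^sub>2"
  obtains p q \<mu> where "p \<in> \<Sigma>\<^sub>1" "norm p < \<rho>" "q \<in> \<Sigma>\<^sub>2" "\<mu> > 0"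
    "(p - q) \<bullet> (p - q) = \<mu> * (\<rho>\<^sup>2 - p \<bullet> p) ^ 4"
    "\<And>x y. x \<in> \<Sigma>\<^sub>1 \<Longrightarrow> y \<in> \<Sigma>\<^sub>2 \<Longrightarrow> norm x \<le> \<rho> \<Longrightarrow> \<mu> * (\<rho>\<^sup>2 - x \<bullet> x) ^ 4 \<le> (x - y) \<bullet> (x - y)"
    "\<mu> * (\<rho>\<^sup>2 - p\<^sub>0 \<bullet> p\<^sub>0) ^ 4 \<le> (p\<^sub>0 - q\<^sub>0) \<bullet> (p\<^sub>0 - q\<^sub>0)"
proof -
  have \<rho>: "\<rho> > 0" using p\<^sub>0 by (meson norm_ge_zero order_le_less_trans)
  define \<phi> where "\<phi> x = \<rho>\<^sup>2 - x \<bullet> x" for x :: 'a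
  define d where "d x y = (x - y) \<bullet> (x - y)" for x y :: 'a
  have \<phi>_nonneg: "0 \<le> \<phi> x" if "norm x \<le> \<rho>" for x
    using that by (simp add: \<phi>_def dot_square_norm power_mono)
  have less_iff: "norm x < \<rho>" if "0 < \<phi> x" for x
    using that \<rho> by (simp add: \<phi>_def dot_square_norm power2_less_imp_less)
  have \<phi>\<^sub>0: "\<phi> p\<^sub>0 > 0" using p\<^sub>0(2) by (simp add: \<phi>_def dot_square_norm power_strict_mono)
  define m where "m = d p\<^sub>0 q\<^sub>0 / \<phi> p\<^sub>0 ^ 4"
  have m: "m \<ge> 0" by (simp add: m_def d_def)
  define K where "K = ((\<Sigma>\<^sub>1 \<inter> cball 0 \<rho>) \<times> \<Sigma>\<^sub>2) \<inter> {z. d (fst z) (snd z) \<le> m * \<phi> (fst z) ^ 4}"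
  have K: "compact K"
    unfolding K_def d_def \<phi>_def
    by (intro compact_Int_closed compact_Times compact closed_cball closed_Collect_le continuous_intros)
  \<comment> \<open>Where \<phi> vanishes, membership in \<open>K\<close> forces |x - y|^2 \<le> 0,
    that is, a common point in the closed ball.\<close>
  have \<phi>_pos: "\<phi> (fst z) > 0" if "z \<in> K" for z
  proof (rule ccontr)
    assume "\<not> ?thesis"
    then have "\<phi> (fst z) = 0" using \<phi>_nonneg[of "fst z"] that by (auto simp: K_def)
    then have "d (fst z) (snd z) \<le> 0" using that by (simp add: K_def)
    then have "fst z = snd z" by (simp add: d_def dot_square_norm)
    with that disj show False by (auto simp: K_def)
  qed
  have z\<^sub>0: "(p\<^sub>0, q\<^sub>0) \<in> K" using p\<^sub>0 q\<^sub>0 \<phi>\<^sub>0 by (simp add: K_def m_def)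
  have "continuous_on K (\<lambda>z. d (fst z) (snd z) / \<phi> (fst z) ^ 4)"
    using \<phi>_pos unfolding d_def \<phi>_def by (intro continuous_intros) force
  then obtain z where z: "z \<in> K"
    and min: "\<And>y. y \<in> K \<Longrightarrow> d (fst z) (snd z) / \<phi> (fst z) ^ 4 \<le> d (fst y) (snd y) / \<phi> (fst y) ^ 4"
    using continuous_attains_inf[OF K] z\<^sub>0 by blast
  obtain p q where pq: "z = (p, q)" by fastforce
  define \<mu> where "\<mu> = d p q / \<phi> p ^ 4"
  have p: "p \<in> \<Sigma>\<^sub>1" "norm p < \<rho>" "q \<in> \<Sigma>\<^sub>2" "\<phi> p > 0"
    using z \<phi>_pos[OF z] less_iff pq by (auto simp: K_def)
  have "p \<noteq> q"
  proof
    assume "p = q"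
    then have "p \<in> cball 0 \<rho> \<inter> \<Sigma>\<^sub>1 \<inter> \<Sigma>\<^sub>2" using p by simp
    with disj show False by blast
  qed
  then have "\<mu> > 0" using p by (simp add: \<mu>_def d_def)
  moreover have "d p q = \<mu> * \<phi> p ^ 4" using p by (simp add: \<mu>_def)
  moreover have le: "\<mu> * \<phi> x ^ 4 \<le> d x y" if x: "x \<in> \<Sigma>\<^sub>1" "y \<in> \<Sigma>\<^sub>2" "norm x \<le> \<rho>" for x y
  proof (cases "(x, y) \<in> K")
    case True
    then show ?thesis using min[OF True] \<phi>_pos[OF True] by (simp add: pq \<mu>_def pos_le_divide_eq)
  next
    \<comment> \<open>Off \<open>K\<close> the bound holds strictly with \<open>m\<close>, and
      \<open>m\<close> is at least the minimum \<open>\<mu>\<close>; avoiding division includes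
      points with \<phi> = 0.\<close>
    case False
    then have "m * \<phi> x ^ 4 \<le> d x y" using x by (simp add: K_def)
    moreover have "\<mu> \<le> m" using min[OF z\<^sub>0] by (simp add: pq \<mu>_def m_def)
    then have "\<mu> * \<phi> x ^ 4 \<le> m * \<phi> x ^ 4" by (intro mult_right_mono) simp_all
    ultimately show ?thesis by linarith
  qed
  ultimately show ?thesis
    using that[of p q \<mu>] p le[OF p\<^sub>0(1) q\<^sub>0] p\<^sub>0(2) by (simp add: d_def \<phi>_def)
qed

text \<open>The weight confines \<open>p\<close> to the ball of radius \<open>\<rho>\<close>, but
  \<open>q\<close> is controlled only through |p - q| < \<rho>. Hence the radius
  \<open>2 * \<rho>\<close>: both points must lie in the open ball of radius \<open>R\<close> to be
  interior.\<close>

lemma shrinkers_intersect: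
  fixes \<Sigma>\<^sub>1 \<Sigma>\<^sub>2 :: "'a::euclidean_space set" and \<rho> R :: real
  assumes dim: "DIM('a) = n + 1" and n: "n \<ge> 1" and \<rho>: "\<rho> > 0" "\<rho>\<^sup>2 = 400 * n" and R: "2 * \<rho> \<le> R"
    and compact: "compact \<Sigma>\<^sub>1" "compact \<Sigma>\<^sub>2" and shrinker: "shrinker n \<Sigma>\<^sub>1" "shrinker n \<Sigma>\<^sub>2"
    and int: "\<Sigma>\<^sub>1 \<inter> ball 0 R \<subseteq> manifold_interior n \<Sigma>\<^sub>1" "\<Sigma>\<^sub>2 \<inter> ball 0 R \<subseteq> manifold_interior n \<Sigma>\<^sub>2"
    and ne: "\<Sigma>\<^sub>1 \<inter> ball 0 R \<noteq> {}" "\<Sigma>\<^sub>2 \<inter> ball 0 R \<noteq> {}"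
  shows "ball 0 (2 * \<rho>) \<inter> \<Sigma>\<^sub>1 \<inter> \<Sigma>\<^sub>2 \<noteq> {}"
proof
  assume disj: "ball 0 (2 * \<rho>) \<inter> \<Sigma>\<^sub>1 \<inter> \<Sigma>\<^sub>2 = {}"
  have "cball (0::'a) \<rho> \<subseteq> ball 0 (2 * \<rho>)" using \<rho>(1) by auto
  then have disj': "cball 0 \<rho> \<inter> \<Sigma>\<^sub>1 \<inter> \<Sigma>\<^sub>2 = {}" using disj by blast
  obtain p\<^sub>0 where p\<^sub>0: "p\<^sub>0 \<in> \<Sigma>\<^sub>1" "p\<^sub>0 \<bullet> p\<^sub>0 \<le> 2 * n"
    using shrinker_point_near_origin[OF shrinker(1) compact(1) ne(1) int(1)] .
  obtain q\<^sub>0 where q\<^sub>0: "q\<^sub>0 \<in> \<Sigma>\<^sub>2" "q\<^sub>0 \<bullet> q\<^sub>0 \<le> 2 * n"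
    using shrinker_point_near_origin[OF shrinker(2) compact(2) ne(2) int(2)] .
  have "norm p\<^sub>0 < \<rho>"
    by (rule power2_less_imp_less) (use p\<^sub>0(2) \<rho> n in \<open>simp_all add: dot_square_norm\<close>)
  from two_point_minimum[OF compact disj' p\<^sub>0(1) this q\<^sub>0(1)]
  obtain p q \<mu> where p: "p \<in> \<Sigma>\<^sub>1" "norm p < \<rho>" and q: "q \<in> \<Sigma>\<^sub>2" and \<mu>: "\<mu> > 0"
    and eq: "(p - q) \<bullet> (p - q) = \<mu> * (\<rho>\<^sup>2 - p \<bullet> p) ^ 4"
    and min: "\<And>x y. x \<in> \<Sigma>\<^sub>1 \<Longrightarrow> y \<in> \<Sigma>\<^sub>2 \<Longrightarrow> norm x \<le> \<rho> \<Longrightarrow> \<mu> * (\<rho>\<^sup>2 - x \<bullet> x) ^ 4 \<le> (x - y) \<bullet> (x - y)"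
    and \<mu>_le: "\<mu> * (\<rho>\<^sup>2 - p\<^sub>0 \<bullet> p\<^sub>0) ^ 4 \<le> (p\<^sub>0 - q\<^sub>0) \<bullet> (p\<^sub>0 - q\<^sub>0)" by blast
  have "(p\<^sub>0 - q\<^sub>0) \<bullet> (p\<^sub>0 - q\<^sub>0) \<le> 8 * n"
  proof -
    \<comment> \<open>By the parallelogram law, |p - q|^2 \<le> 2 |p|^2 + 2 |q|^2 for the two
      starting points.\<close>
    have "0 \<le> (p\<^sub>0 + q\<^sub>0) \<bullet> (p\<^sub>0 + q\<^sub>0)" by simp
    then show ?thesis using p\<^sub>0(2) q\<^sub>0(2)
      by (simp add: inner_add_left inner_add_right inner_diff_left inner_diff_right)
  qed
  \<comment> \<open>398 = 400 - 2, from |p|^2 \<le> 2 n at the first starting point.\<close>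
  moreover have "\<mu> * (398 * real n) ^ 4 \<le> \<mu> * (\<rho>\<^sup>2 - p\<^sub>0 \<bullet> p\<^sub>0) ^ 4"
    using \<mu> p\<^sub>0(2) \<rho>(2) by (intro mult_left_mono power_mono) auto
  ultimately have "\<mu> * (398 * real n) ^ 4 \<le> 8 * n" using \<mu>_le by linarith
  then have \<mu>_n: "\<mu> * (398 ^ 4 * real n ^ 3) \<le> 8"
    using n by (simp add: power_mult_distrib eval_nat_numeral)
  have "\<rho> ^ 6 = (\<rho>\<^sup>2) ^ 3" by (simp add: power_mult[symmetric])
  also have "\<dots> = 400 ^ 3 * real n ^ 3" using \<rho>(2) by (simp add: power_mult_distrib)
  finally have \<rho>6: "\<rho> ^ 6 = 400 ^ 3 * real n ^ 3" .
  \<comment> \<open>Numerically, 18 * 8 * 400^3 \<le> 398^4.\<close>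
  have small: "18 * \<mu> * \<rho> ^ 6 \<le> 1" using \<mu>_n \<mu> n unfolding \<rho>6 by simp
  have "norm (p - q) < \<rho>"
  proof (rule power2_less_imp_less)
    have "(norm (p - q))\<^sup>2 = \<mu> * (\<rho>\<^sup>2 - p \<bullet> p) ^ 4" using eq by (simp add: dot_square_norm)
    also have "\<dots> \<le> \<mu> * (\<rho>\<^sup>2) ^ 4"
      using \<mu> p(2) by (intro mult_left_mono power_mono) (simp_all add: dot_square_norm power_mono)
    also have "\<dots> = (\<mu> * \<rho> ^ 6) * \<rho>\<^sup>2" by (simp add: power_mult[symmetric] power_add[symmetric])
    also have "\<dots> < 1 * \<rho>\<^sup>2" using small \<rho>(1) by (intro mult_strict_right_mono) auto
    finally show "(norm (p - q))\<^sup>2 < \<rho>\<^sup>2" by simp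
  qed (use \<rho> in simp)
  then have "norm q < 2 * \<rho>" using norm_triangle_sub[of q p] p(2) by (simp add: norm_minus_commute)
  then have "p \<in> manifold_interior n \<Sigma>\<^sub>1" "q \<in> manifold_interior n \<Sigma>\<^sub>2"
    using int p q R \<rho>(1) by auto
  from two_point_bound[OF dim shrinker this p(2) \<mu> small eq min] show False using \<rho>(2) n by simp
qed

theorem theorem1p1:
  fixes n :: nat
  assumes "n \<ge> 1" and "CARD('n::finite) = n + 1"
  shows "\<exists>R\<^sub>n > 0. \<forall>R \<ge> R\<^sub>n. \<forall>\<Sigma>\<^sub>1 \<Sigma>\<^sub>2 :: (real ^ 'n) set.
    compact \<Sigma>\<^sub>1 \<and> shrinker n \<Sigma>\<^sub>1 \<and> \<Sigma>\<^sub>1 \<subseteq> cball 0 R \<and>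
      manifold_boundary n \<Sigma>\<^sub>1 \<subseteq> sphere 0 R \<and> ball 0 R \<inter> \<Sigma>\<^sub>1 \<noteq> {} \<and>
    compact \<Sigma>\<^sub>2 \<and> shrinker n \<Sigma>\<^sub>2 \<and> \<Sigma>\<^sub>2 \<subseteq> cball 0 R \<and>
      manifold_boundary n \<Sigma>\<^sub>2 \<subseteq> sphere 0 R \<and> ball 0 R \<inter> \<Sigma>\<^sub>2 \<noteq> {} \<longrightarrow>
    ball 0 R\<^sub>n \<inter> \<Sigma>\<^sub>1 \<inter> \<Sigma>\<^sub>2 \<noteq> {}"
proof -
  \<comment> \<open>With \<rho>^2 = K n the estimates ask for K > 8 and 144 K^3 \<le> (K - 2)^4; K =
    400 is a convenient choice. The resulting constant is 2 \<rho> = 40 sqrt n.\<close>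
  define \<rho> where "\<rho> = 20 * sqrt n"
  have \<rho>: "\<rho> > 0" "\<rho>\<^sup>2 = 400 * n" using assms(1) by (simp_all add: \<rho>_def power_mult_distrib)
  have interior: "\<Sigma> \<inter> ball 0 R \<subseteq> manifold_interior n \<Sigma>"
    if "shrinker n \<Sigma>" "manifold_boundary n \<Sigma> \<subseteq> sphere 0 R" for \<Sigma> :: "(real ^ 'n) set" and R
    using that unfolding shrinker_def embedded_submanifold_def by fastforce
  have dim: "DIM(real ^ 'n) = n + 1" using assms(2) by simp
  show ?thesis
  proof (intro exI[of _ "2 * \<rho>"] conjI allI impI; (elim conjE)?)
    show "2 * \<rho> > 0" using \<rho> by simp
  next
    fix R and \<Sigma>\<^sub>1 \<Sigma>\<^sub>2 :: "(real ^ 'n) set"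
    assume "2 * \<rho> \<le> R" "compact \<Sigma>\<^sub>1" "compact \<Sigma>\<^sub>2" "shrinker n \<Sigma>\<^sub>1" "shrinker n \<Sigma>\<^sub>2"
      "manifold_boundary n \<Sigma>\<^sub>1 \<subseteq> sphere 0 R" "manifold_boundary n \<Sigma>\<^sub>2 \<subseteq> sphere 0 R"
      "ball 0 R \<inter> \<Sigma>\<^sub>1 \<noteq> {}" "ball 0 R \<inter> \<Sigma>\<^sub>2 \<noteq> {}"
    then show "ball 0 (2 * \<rho>) \<inter> \<Sigma>\<^sub>1 \<inter> \<Sigma>\<^sub>2 \<noteq> {}"
      by (intro shrinkers_intersect[OF dim assms(1) \<rho>, of R] interior) (simp_all add: Int_commute)
  qed
qed

end
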